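(* Let $\mathcal{U}=\{U_j\}$ be a good, finite open cover of a paracompact space $B$ and let $\Omega\in\check Z^1_\varepsilon(\mathcal{U};\underline{O(2)})$ for some $\varepsilon<\frac19$. Let $\omega$ and $\tilde e$ be the output of the following algorithm: (1) $\omega_{jk}=\det(\Omega_{jk})$ for all $(jk)\in\mathcal{N}(\mathcal{U})$; (2) for each $(jk)\in\mathcal{N}(\mathcal{U})$ set $\Lambda_{jk}=\Omega_{jk}\,r(\omega_{jk})\in SO(2)$, where $r(\pm1)=\mathrm{diag}(1,\pm1)$, and choose $\Theta_{jk}\in\mathbb{R}$ such that $\Lambda_{jk}$ is rotation by $2\pi\Theta_{jk}$; (3) for each $(jkl)\in\mathcal{N}(\mathcal{U})$ set $\tilde e_{jkl}=\langle\omega_{jk}\Theta_{kl}-\Theta_{jl}+\Theta_{jk}\rangle$, where $\langle\cdot\rangle$ denotes the nearest integer. Then $\omega$ and $\tilde e$ represent the characteristic classes (first Stiefel–Whitney class and twisted Euler class) associated with $[\Pi_Z(\Omega)]\in\check H^1(\mathcal{U};\mathcal{C}_{O(2)})$.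
   Context: **Cocycles.** A good cover has all nonempty finite intersections contractible. $U_{jk}=U_j\cap U_k$, $U_{jkl}=U_j\cap U_k\cap U_l$; $(jk),(jkl)\in\mathcal{N}(\mathcal{U})$ mean these are nonempty (indices not necessarily distinct). $\check Z^1_\varepsilon(\mathcal{U};\mathcal{C}_{O(2)})$ is the set of families of continuous maps $\Omega_{jk}:U_{jk}\to O(2)$ with $\sup_{(jkl)}\sup_{b\in U_{jkl}}\|\Omega_{jk}(b)\Omega_{kl}(b)-\Omega_{jl}(b)\|_F<\varepsilon$; $\check Z^1_\varepsilon(\mathcal{U};\underline{O(2)})$ is the subset of locally constant ones (constant matrices $\Omega_{jk}$, for a good cover). $\check Z^1(\mathcal{U};\mathcal{C}_{O(2)})$ denotes exact cocycles ($\Omega_{jk}\Omega_{kl}=\Omega_{jl}$) and $\check H^1(\mathcal{U};\mathcal{C}_{O(2)})$ its quotient by $\Omega_{jk}\sim\mu_j\Omega_{jk}\mu_k^{-1}$, $\mu_j:U_j\to O(2)$ continuous. **Characteristic classes.** For a cocycle $\omega=\{\omega_{jk}\in\{\pm1\}\}$, $\check C^p(\mathcal{U};\mathbb{Z}_\omega)$ consists of families of integers indexed by $(j_0\cdots j_p)\in\mathcal{N}(\mathcal{U})$, with $(\delta_\omega\beta)_{jkl}=\omega_{jk}\beta_{kl}-\beta_{jl}+\beta_{jk}$, $(\delta_\omega e)_{jklm}=\omega_{jk}e_{klm}-e_{jlm}+e_{jkm}-e_{jkl}$, and cohomology $\check H^2(\mathcal{U};\mathbb{Z}_\omega)$. For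 an exact cocycle $\widetilde\Omega\in\check Z^1(\mathcal{U};\mathcal{C}_{O(2)})$, let $\tilde\omega_{jk}=\det\widetilde\Omega_{jk}$ and choose continuous $\widetilde\Theta_{jk}:U_{jk}\to\mathbb{R}$ such that $\widetilde\Omega_{jk}r(\tilde\omega_{jk})$ is rotation by $2\pi\widetilde\Theta_{jk}$; the first Stiefel–Whitney class is $[\tilde\omega]\in\check H^1(\mathcal{U};\underline{\mathbb{Z}_2})$ and the twisted Euler class is the class of the integer cocycle $\tilde\omega_{jk}\widetilde\Theta_{kl}-\widetilde\Theta_{jl}+\widetilde\Theta_{jk}$ in $\check H^2(\mathcal{U};\mathbb{Z}_{\tilde\omega})$. The pair (Stiefel–Whitney class, twisted Euler class) depends only on the class of $\widetilde\Omega$ once pairs $(\omega,[e_{jkl}])$ and $(\omega',[\phi_je_{jkl}])$ with $\omega'_{jk}=\phi_j\omega_{jk}\phi_k$, $\phi_j\in\{\pm1\}$, are identified. **The map $\Pi_Z$.** Index $\mathcal{U}$ by a subset of $\mathbb{N}$ and fix a partition of unity $\{\rho_j\}$ subordinate to $\mathcal{U}$. $\mathrm{Gr}(2)$ is the space of 2-planes in $\mathbb{R}^\infty$, identified with orthogonal projection matrices; $V(2)=\{A\in\mathbb{R}^{\infty\times2}:A^TA=I_2\}$. For $\Omega\in\check Z^1_\varepsilon(\mathcal{U};\mathcal{C}_{O(2)})$, $\varepsilon<\frac12$, let $\Psi_j:U_j\to V(2)$ have $i$-th $2\times2$ block $\sqrt{\rho_i(b)}\,\Omega_{ij}(b)$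 (zero if $\rho_i(b)=0$), $\mathrm{cl}(\Omega)(b)=\sum_j\rho_j(b)\Psi_j(b)\Psi_j(b)^T$, and $f_\Omega(b)=\Pi(\mathrm{cl}(\Omega)(b))$, where $\Pi(A)$ is the orthogonal projection onto the span of the eigenvectors of $\frac{A+A^T}{2}$ for its two largest eigenvalues. Let $\widetilde\Psi_j(b)\in V(2)$ be the factor $U$ in the polar decomposition $f_\Omega(b)\Psi_j(b)=UH$. Then $\Pi_Z(\Omega)_{jk}(b)=\widetilde\Psi_j(b)^T\widetilde\Psi_k(b)$. (Known results of Scoccola–Perea: for $\varepsilon<\frac12$ this is a well-defined element of $\check Z^1(\mathcal{U};\mathcal{C}_{O(2)})$, and if $\varepsilon<\frac{\sqrt2}{4}$ then $\sup_{j,k}\sup_{b}\|\Omega_{jk}(b)-\Pi_Z(\Omega)_{jk}(b)\|_F<9\varepsilon$.) *)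

theory Defs
  imports "HOL-Analysis.Analysis" "HOL-Library.Groups_Big_Fun"
begin

section \<open>Covers\<close>

text \<open>No separation axiom is built in; Hausdorff spaces are covered as a special case.\<close>

definition paracompact_space :: "'b topology \<Rightarrow> bool" where
  "paracompact_space B \<longleftrightarrow>
     (\<forall>\<C>. (\<forall>C\<in>\<C>. openin B C) \<and> \<Union>\<C> = topspace B \<longrightarrow>
        (\<exists>\<D>. (\<forall>D\<in>\<D>. openin B D \<and> (\<exists>C\<in>\<C>. D \<subseteq> C)) \<and> \<Union>\<D> = topspace B \<and>
             locally_finite_in B \<D>))"

text \<open>Simplices are lists of indices, repetitions allowed.\<close>

definition nerve :: "nat set \<Rightarrow> (nat \<Rightarrow> 'b set) \<Rightarrow> nat list set" where
  "nerve J U = {js. js \<noteq> [] \<and> set js \<subseteq> J \<and> (\<Inter>j\<in>set js. U j) \<noteq> {}}"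

definition good_open_cover :: "'b topology \<Rightarrow> nat set \<Rightarrow> (nat \<Rightarrow> 'b set) \<Rightarrow> bool" where
  "good_open_cover B J U \<longleftrightarrow>
     (\<forall>j\<in>J. openin B (U j)) \<and> (\<Union>j\<in>J. U j) = topspace B \<and>
     (\<forall>js\<in>nerve J U. contractible_space (subtopology B (\<Inter>j\<in>set js. U j)))"

text \<open>For a finite index set, so that local finiteness of the supports is automatic.\<close>

definition partition_of_unity ::
  "'b topology \<Rightarrow> nat set \<Rightarrow> (nat \<Rightarrow> 'b set) \<Rightarrow> (nat \<Rightarrow> 'b \<Rightarrow> real) \<Rightarrow> bool" where
  "partition_of_unity B J U \<rho> \<longleftrightarrow>
     (\<forall>j\<in>J. continuous_map B euclideanreal (\<rho> j)) \<and>
     (\<forall>j\<in>J. \<forall>b\<in>topspace B. 0 \<le> \<rho> j b) \<and>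
     (\<forall>b\<in>topspace B. (\<Sum>j\<in>J. \<rho> j b) = 1) \<and>
     (\<forall>j\<in>J. B closure_of {b\<in>topspace B. \<rho> j b \<noteq> 0} \<subseteq> U j)"

section \<open>Exact and approximate cocycles with values in O(2)\<close>

text \<open>Families are total functions; only their values \<open>\<Omega> j k b\<close> with
  \<open>j, k \<in> J\<close> and \<open>b \<in> U j \<inter> U k\<close> are meaningful.\<close>

type_synonym 'b family = "nat \<Rightarrow> nat \<Rightarrow> 'b \<Rightarrow> real^2^2"

definition O2 :: "(real^2^2) set" where
  "O2 = {A. orthogonal_matrix A}"

definition O2_cochains :: "'b topology \<Rightarrow> nat set \<Rightarrow> (nat \<Rightarrow> 'b set) \<Rightarrow> 'b family set" where
  "O2_cochains B J U =
     {\<Omega>. \<forall>j k. [j,k] \<in> nerve J U \<longrightarrow>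
           continuous_map (subtopology B (U j \<inter> U k)) (top_of_set O2) (\<Omega> j k)}"

definition O2_cocycles :: "'b topology \<Rightarrow> nat set \<Rightarrow> (nat \<Rightarrow> 'b set) \<Rightarrow> 'b family set" where
  "O2_cocycles B J U =
     {\<Omega> \<in> O2_cochains B J U.
        \<forall>j k l. [j,k,l] \<in> nerve J U \<longrightarrow>
          (\<forall>b \<in> U j \<inter> U k \<inter> U l. \<Omega> j k b ** \<Omega> k l b = \<Omega> j l b)}"

text \<open>The norm of the type \<^typ>\<open>real^2^2\<close> is the Frobenius norm.  The supremum is taken in
  \<open>[0,\<infinity>]\<close>, where it always exists.\<close>

definition approx_O2_cocycles ::
  "'b topology \<Rightarrow> nat set \<Rightarrow> (nat \<Rightarrow> 'b set) \<Rightarrow> real \<Rightarrow> 'b family set" where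
  "approx_O2_cocycles B J U \<epsilon> =
     {\<Omega> \<in> O2_cochains B J U.
        (SUP (j,k,l) \<in> {(j,k,l). [j,k,l] \<in> nerve J U}. SUP b \<in> U j \<inter> U k \<inter> U l.
           ennreal (norm (\<Omega> j k b ** \<Omega> k l b - \<Omega> j l b))) < ennreal \<epsilon>}"

text \<open>Locally constant means continuous for the discrete topology on O(2).\<close>

definition discrete_approx_O2_cocycles ::
  "'b topology \<Rightarrow> nat set \<Rightarrow> (nat \<Rightarrow> 'b set) \<Rightarrow> real \<Rightarrow> 'b family set" where
  "discrete_approx_O2_cocycles B J U \<epsilon> =
     {\<Omega> \<in> approx_O2_cocycles B J U \<epsilon>.
        \<forall>j k. [j,k] \<in> nerve J U \<longrightarrow>
          continuous_map (subtopology B (U j \<inter> U k)) (discrete_topology O2) (\<Omega> j k)}"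

section \<open>Characteristic classes\<close>

definition refl2 :: "int \<Rightarrow> real^2^2" where
  "refl2 s = vector [vector [1, 0], vector [0, of_int s]]"

definition rotation2 :: "real \<Rightarrow> real^2^2" where
  "rotation2 t = vector [vector [cos t, - sin t], vector [sin t, cos t]]"

definition sign_cocycles :: "nat set \<Rightarrow> (nat \<Rightarrow> 'b set) \<Rightarrow> (nat \<Rightarrow> nat \<Rightarrow> int) set" where
  "sign_cocycles J U =
     {\<omega>. (\<forall>j k. [j,k] \<in> nerve J U \<longrightarrow> \<omega> j k \<in> {1, -1}) \<and>
         (\<forall>j k l. [j,k,l] \<in> nerve J U \<longrightarrow> \<omega> j k * \<omega> k l = \<omega> j l)}"

definition twisted_delta1 ::
  "(nat \<Rightarrow> nat \<Rightarrow> int) \<Rightarrow> (nat \<Rightarrow> nat \<Rightarrow> int) \<Rightarrow> nat \<Rightarrow> nat \<Rightarrow> nat \<Rightarrow> int" where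
  "twisted_delta1 \<omega> \<beta> j k l = \<omega> j k * \<beta> k l - \<beta> j l + \<beta> j k"

definition twisted_delta2 ::
  "(nat \<Rightarrow> nat \<Rightarrow> int) \<Rightarrow> (nat \<Rightarrow> nat \<Rightarrow> nat \<Rightarrow> int) \<Rightarrow> nat \<Rightarrow> nat \<Rightarrow> nat \<Rightarrow> nat \<Rightarrow> int" where
  "twisted_delta2 \<omega> e j k l m = \<omega> j k * e k l m - e j l m + e j k m - e j k l"

definition twisted_2_cocycles ::
  "nat set \<Rightarrow> (nat \<Rightarrow> 'b set) \<Rightarrow> (nat \<Rightarrow> nat \<Rightarrow> int) \<Rightarrow> (nat \<Rightarrow> nat \<Rightarrow> nat \<Rightarrow> int) set" where
  "twisted_2_cocycles J U \<omega> =
     {e. \<forall>j k l m. [j,k,l,m] \<in> nerve J U \<longrightarrow> twisted_delta2 \<omega> e j k l m = 0}"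

definition twisted_cohomologous ::
  "nat set \<Rightarrow> (nat \<Rightarrow> 'b set) \<Rightarrow> (nat \<Rightarrow> nat \<Rightarrow> int) \<Rightarrow>
     (nat \<Rightarrow> nat \<Rightarrow> nat \<Rightarrow> int) \<Rightarrow> (nat \<Rightarrow> nat \<Rightarrow> nat \<Rightarrow> int) \<Rightarrow> bool" where
  "twisted_cohomologous J U \<omega> e e' \<longleftrightarrow>
     (\<exists>\<beta>. \<forall>j k l. [j,k,l] \<in> nerve J U \<longrightarrow> e j k l - e' j k l = twisted_delta1 \<omega> \<beta> j k l)"

text \<open>The identification of \<open>(\<omega>, [e])\<close> with \<open>(\<phi>\<^sub>j \<omega>\<^sub>j\<^sub>k \<phi>\<^sub>k, [\<phi>\<^sub>j e\<^sub>j\<^sub>k\<^sub>l])\<close>.  Its first component says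
  that \<open>\<omega>\<close> and \<open>\<omega>'\<close> define the same class with coefficients in the group of signs.\<close>

definition equivalent_pairs ::
  "nat set \<Rightarrow> (nat \<Rightarrow> 'b set) \<Rightarrow> (nat \<Rightarrow> nat \<Rightarrow> int) \<times> (nat \<Rightarrow> nat \<Rightarrow> nat \<Rightarrow> int) \<Rightarrow>
     (nat \<Rightarrow> nat \<Rightarrow> int) \<times> (nat \<Rightarrow> nat \<Rightarrow> nat \<Rightarrow> int) \<Rightarrow> bool" where
  "equivalent_pairs J U = (\<lambda>(\<omega>, e) (\<omega>', e').
     \<exists>\<phi>. (\<forall>j\<in>J. \<phi> j \<in> {1, -1}) \<and>
         (\<forall>j k. [j,k] \<in> nerve J U \<longrightarrow> \<omega>' j k = \<phi> j * \<omega> j k * \<phi> k) \<and>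
         twisted_cohomologous J U \<omega>' (\<lambda>j k l. \<phi> j * e j k l) e')"

text \<open>The cocycles computed from an exact cocycle \<open>W\<close> by taking determinants and choosing
  continuous angles \<open>\<Theta>\<close> (in full turns).\<close>

definition characteristic_cocycles ::
  "'b topology \<Rightarrow> nat set \<Rightarrow> (nat \<Rightarrow> 'b set) \<Rightarrow> 'b family \<Rightarrow>
     ((nat \<Rightarrow> nat \<Rightarrow> int) \<times> (nat \<Rightarrow> nat \<Rightarrow> nat \<Rightarrow> int)) set" where
  "characteristic_cocycles B J U W =
     {(\<omega>, e). \<exists>\<Theta> :: nat \<Rightarrow> nat \<Rightarrow> 'b \<Rightarrow> real.
        (\<forall>j k. [j,k] \<in> nerve J U \<longrightarrow>
           continuous_map (subtopology B (U j \<inter> U k)) euclideanreal (\<Theta> j k) \<and>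
           (\<forall>b \<in> U j \<inter> U k.
              real_of_int (\<omega> j k) = det (W j k b) \<and>
              W j k b ** refl2 (\<omega> j k) = rotation2 (2 * pi * \<Theta> j k b))) \<and>
        (\<forall>j k l. [j,k,l] \<in> nerve J U \<longrightarrow>
           (\<forall>b \<in> U j \<inter> U k \<inter> U l.
              real_of_int (e j k l) = of_int (\<omega> j k) * \<Theta> k l b - \<Theta> j l b + \<Theta> j k b))}"

text \<open>The characteristic classes of the cohomology class of \<open>W\<close> are computed on the
  representative \<open>W\<close>.  The choice of angles is immaterial, so a representing pair has to be
  equivalent to the outcome of every choice; that there is a choice is demanded separately.\<close>

definition represents_characteristic_classes ::
  "'b topology \<Rightarrow> nat set \<Rightarrow> (nat \<Rightarrow> 'b set) \<Rightarrow> 'b family \<Rightarrow>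
     (nat \<Rightarrow> nat \<Rightarrow> int) \<Rightarrow> (nat \<Rightarrow> nat \<Rightarrow> nat \<Rightarrow> int) \<Rightarrow> bool" where
  "represents_characteristic_classes B J U W \<omega> e \<longleftrightarrow>
     \<omega> \<in> sign_cocycles J U \<and> e \<in> twisted_2_cocycles J U \<omega> \<and>
     characteristic_cocycles B J U W \<noteq> {} \<and>
     (\<forall>p \<in> characteristic_cocycles B J U W. equivalent_pairs J U (\<omega>, e) p)"

section \<open>Linear algebra in infinitely many coordinates\<close>

text \<open>The space of finitely supported real sequences is split into consecutive pairs of
  coordinates: a vector is a finitely supported sequence of elements of \<^typ>\<open>real^2\<close>, an
  \<open>\<infinity>\<times>2\<close> matrix a sequence of \<open>2\<times>2\<close> blocks, and an \<open>\<infinity>\<times>\<infinity>\<close> matrix a doubly indexed family of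
  \<open>2\<times>2\<close> blocks.  \<^const>\<open>Sum_any\<close> is the sum of a finitely supported function.\<close>

type_synonym inf_vec = "nat \<Rightarrow> real^2"
type_synonym inf_frame = "nat \<Rightarrow> real^2^2"
type_synonym inf_mat = "nat \<Rightarrow> nat \<Rightarrow> real^2^2"

definition R_inf :: "inf_vec set" where
  "R_inf = {x. finite {i. x i \<noteq> 0}}"

definition inner_inf :: "inf_vec \<Rightarrow> inf_vec \<Rightarrow> real" where
  "inner_inf x y = Sum_any (\<lambda>i. x i \<bullet> y i)"

definition mat_vec_inf :: "inf_mat \<Rightarrow> inf_vec \<Rightarrow> inf_vec" where
  "mat_vec_inf A x = (\<lambda>i. Sum_any (\<lambda>k. A i k *v x k))"

definition mat_frame_inf :: "inf_mat \<Rightarrow> inf_frame \<Rightarrow> inf_frame" where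
  "mat_frame_inf A M = (\<lambda>i. Sum_any (\<lambda>k. A i k ** M k))"

text \<open>The \<open>2\<times>2\<close> matrix \<open>M\<^sup>T N\<close>.\<close>

definition gram_inf :: "inf_frame \<Rightarrow> inf_frame \<Rightarrow> real^2^2" where
  "gram_inf M N = Sum_any (\<lambda>i. transpose (M i) ** N i)"

definition V2 :: "inf_frame set" where
  "V2 = {M. finite {i. M i \<noteq> 0} \<and> gram_inf M M = mat 1}"

definition eigenvector_inf :: "inf_mat \<Rightarrow> real \<Rightarrow> inf_vec \<Rightarrow> bool" where
  "eigenvector_inf A c x \<longleftrightarrow>
     x \<in> R_inf \<and> x \<noteq> (\<lambda>i. 0) \<and> mat_vec_inf A x = (\<lambda>i. c *\<^sub>R x i)"

text \<open>Orthonormal eigenvectors \<open>v, w\<close> of a symmetric matrix for its two largest eigenvalues,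
  counted with multiplicity.\<close>

definition top_eigenvectors :: "inf_mat \<Rightarrow> inf_vec \<Rightarrow> inf_vec \<Rightarrow> bool" where
  "top_eigenvectors A v w \<longleftrightarrow>
     inner_inf v v = 1 \<and> inner_inf w w = 1 \<and> inner_inf v w = 0 \<and>
     (\<exists>c d. eigenvector_inf A c v \<and> eigenvector_inf A d w \<and>
        (\<forall>s x. eigenvector_inf A s x \<and> inner_inf x v = 0 \<and> inner_inf x w = 0 \<longrightarrow>
           s \<le> c \<and> s \<le> d))"

definition orthogonal_projection_onto :: "inf_vec set \<Rightarrow> inf_mat \<Rightarrow> bool" where
  "orthogonal_projection_onto S P \<longleftrightarrow>
     (\<forall>x\<in>R_inf. mat_vec_inf P x \<in> S \<and>
        (\<forall>y\<in>S. inner_inf (\<lambda>i. x i - mat_vec_inf P x i) y = 0))"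

definition span2_inf :: "inf_vec \<Rightarrow> inf_vec \<Rightarrow> inf_vec set" where
  "span2_inf v w = {(\<lambda>i. a *\<^sub>R v i + c *\<^sub>R w i) | a c. True}"

definition sym_part :: "inf_mat \<Rightarrow> inf_mat" where
  "sym_part A = (\<lambda>i k. (1/2) *\<^sub>R (A i k + transpose (A k i)))"

text \<open>Uniquely determined when the second and third largest eigenvalues differ.\<close>

definition Pi_Gr :: "inf_mat \<Rightarrow> inf_mat" where
  "Pi_Gr A =
     (SOME P. \<exists>v w. top_eigenvectors (sym_part A) v w \<and>
        orthogonal_projection_onto (span2_inf v w) P)"

text \<open>The factor \<open>Q\<close> in \<open>M = Q H\<close>; uniquely determined when \<open>M\<close> has rank two.\<close>

definition polar_factor :: "inf_frame \<Rightarrow> inf_frame" where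
  "polar_factor M =
     (SOME Q. Q \<in> V2 \<and>
        (\<exists>H :: real^2^2. transpose H = H \<and> (\<forall>x. 0 \<le> x \<bullet> (H *v x)) \<and> M = (\<lambda>i. Q i ** H)))"

section \<open>Turning approximate cocycles into exact ones\<close>

definition Psi :: "nat set \<Rightarrow> (nat \<Rightarrow> 'b \<Rightarrow> real) \<Rightarrow> 'b family \<Rightarrow> nat \<Rightarrow> 'b \<Rightarrow> inf_frame" where
  "Psi J \<rho> \<Omega> j b =
     (\<lambda>i. if i \<in> J \<and> \<rho> i b \<noteq> 0 then sqrt (\<rho> i b) *\<^sub>R \<Omega> i j b else 0)"

definition cl :: "nat set \<Rightarrow> (nat \<Rightarrow> 'b \<Rightarrow> real) \<Rightarrow> 'b family \<Rightarrow> 'b \<Rightarrow> inf_mat" where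
  "cl J \<rho> \<Omega> b =
     (\<lambda>i k. \<Sum>j\<in>J. \<rho> j b *\<^sub>R (Psi J \<rho> \<Omega> j b i ** transpose (Psi J \<rho> \<Omega> j b k)))"

definition classifying_map ::
  "nat set \<Rightarrow> (nat \<Rightarrow> 'b \<Rightarrow> real) \<Rightarrow> 'b family \<Rightarrow> 'b \<Rightarrow> inf_mat" where
  "classifying_map J \<rho> \<Omega> b = Pi_Gr (cl J \<rho> \<Omega> b)"

definition Psi_tilde ::
  "nat set \<Rightarrow> (nat \<Rightarrow> 'b \<Rightarrow> real) \<Rightarrow> 'b family \<Rightarrow> nat \<Rightarrow> 'b \<Rightarrow> inf_frame" where
  "Psi_tilde J \<rho> \<Omega> j b =
     polar_factor (mat_frame_inf (classifying_map J \<rho> \<Omega> b) (Psi J \<rho> \<Omega> j b))"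

definition Pi_Z :: "nat set \<Rightarrow> (nat \<Rightarrow> 'b \<Rightarrow> real) \<Rightarrow> 'b family \<Rightarrow> 'b family" where
  "Pi_Z J \<rho> \<Omega> j k b = gram_inf (Psi_tilde J \<rho> \<Omega> j b) (Psi_tilde J \<rho> \<Omega> k b)"

end

theory Submission
  imports Defs
begin

text \<open>On each overlap \<open>\<Omega>\<close> is a constant matrix \<open>C\<^sub>j\<^sub>k\<close>, so all data of the construction at a
  point \<open>b\<close> depend only on the weights \<open>\<rho>\<^sub>i b\<close>.  Write \<open>E(Q)\<close> for the trace of \<open>Q\<^sup>T cl(\<Omega>)(b) Q\<close>.
  The frames \<open>\<Psi>\<^sub>j\<close> almost maximise this energy, \<open>E(\<Psi>\<^sub>j) \<ge> 2 - \<epsilon>\<^sup>2\<close>, while \<open>cl(\<Omega>)(b)\<close> is positive with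
  trace \<open>2\<close>; hence its third eigenvalue is at most \<open>\<epsilon>\<^sup>2\<close>.  With this gap, a frame \<open>V\<close> of the top
  eigenspace satisfies \<open>E(V) - E(Q) \<ge> (1 - 2 \<epsilon>\<^sup>2) (2 - |V\<^sup>T Q|\<^sup>2)\<close> for every orthonormal \<open>Q\<close>.  Taking
  \<open>Q = \<Psi>\<^sub>j\<close> shows that \<open>V\<^sup>T \<Psi>\<^sub>j\<close> is almost orthogonal; taking for \<open>Q\<close> the frame of a nearby point
  shows that \<open>V V\<^sup>T\<close> is continuous.  If \<open>R\<^sub>j\<close> is the orthogonal polar factor of \<open>V\<^sup>T \<Psi>\<^sub>j\<close>, then
  \<open>\<Pi>\<^sub>Z(\<Omega>)\<^sub>j\<^sub>k = R\<^sub>j\<^sup>T R\<^sub>k\<close>, which is an exact cocycle at distance less than \<open>1\<close> from \<open>C\<^sub>j\<^sub>k\<close>.  Therefore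
  determinants agree, the angles of \<open>\<Pi>\<^sub>Z(\<Omega>)\<close> can be chosen within \<open>1/6\<close> of a turn of those of \<open>\<Omega>\<close>,
  and the three angle errors in an exact coboundary add up to less than \<open>1/2\<close>: rounding recovers it.\<close>

subsection \<open>Two-by-two matrices\<close>

lemmas matrix2_simps = vec_eq_iff forall_2 sum_2 matrix_matrix_mult_def matrix_vector_mult_def
  vector_matrix_mult_def transpose_def inner_vec_def mat_def column_def det_2

lemma inner_matrix_mult_left: "(A ** B) \<bullet> C = B \<bullet> (transpose A ** C)"
  for A B C :: "real^2^2"
  by (simp add: matrix2_simps algebra_simps)

lemma inner_matrix_mult_right: "(A ** B) \<bullet> C = A \<bullet> (C ** transpose B)"
  for A B C :: "real^2^2"
  by (simp add: matrix2_simps algebra_simps)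

text \<open>Cyclicity of the trace. It turns pairings of blocks of two projections into pairings of
  the products that add up to \<open>gram_inf\<close>.\<close>

lemma inner_mult_transpose:
  "(A ** transpose B) \<bullet> (C ** transpose D) = (transpose A ** C) \<bullet> (transpose B ** D)"
  for A B C D :: "real^2^2"
  by (simp add: matrix2_simps algebra_simps)

lemma norm_mat_1_2: "(norm (mat 1 :: real^2^2))\<^sup>2 = 2"
  by (simp add: power2_norm_eq_inner matrix2_simps)

lemma norm_transpose2: "norm (transpose A) = norm A" for A :: "real^2^2"
  by (simp add: norm_eq_sqrt_inner matrix2_simps algebra_simps)

lemma norm_orthogonal_mult:
  fixes Q X :: "real^2^2"
  assumes "orthogonal_matrix Q"
  shows "norm (Q ** X) = norm X" "norm (X ** Q) = norm X"
proof -
  have *: "transpose Q ** Q = mat 1" "Q ** transpose Q = mat 1"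
    using assms by (auto simp: orthogonal_matrix_def)
  have "(Q ** X) \<bullet> (Q ** X) = X \<bullet> X"
    by (simp add: inner_matrix_mult_left matrix_mul_assoc *)
  then show "norm (Q ** X) = norm X"
    by (simp add: norm_eq_sqrt_inner)
  have "(X ** Q) \<bullet> (X ** Q) = X \<bullet> X"
    by (simp add: inner_matrix_mult_right matrix_mul_assoc[symmetric] *)
  then show "norm (X ** Q) = norm X"
    by (simp add: norm_eq_sqrt_inner)
qed

subsection \<open>Polar decomposition of two-by-two matrices\<close>

definition psd2 :: "real^2^2 \<Rightarrow> bool" where
  "psd2 H \<longleftrightarrow> transpose H = H \<and> (\<forall>x. 0 \<le> x \<bullet> (H *v x))"

text \<open>By the theorem of Cayley and Hamilton a root \<open>H\<close> of \<open>S\<close> satisfies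
  \<open>trace H \<cdot> H = S + det H \<cdot> 1\<close>, where \<open>det H = \<surd>det S\<close> and
  \<open>trace H = \<surd>(trace S + 2 \<surd>det S)\<close>.\<close>

definition inv_sqrt2 :: "real^2^2 \<Rightarrow> real^2^2" where
  "inv_sqrt2 S = (1 / (sqrt (det S) * sqrt (trace S + 2 * sqrt (det S)))) *\<^sub>R
     ((trace S + sqrt (det S)) *\<^sub>R mat 1 - S)"

lemma trace_2: "trace A = A$1$1 + A$2$2" for A :: "real^2^2"
  by (simp add: trace_def sum_2)

text \<open>Writing p, q, r for the entries, the form at (a, b) is p a^2 + 2 q a b + r b^2. Suitable
  test vectors give one direction. For the other, |q| <= sqrt p * sqrt r, so the form dominates the
  square of |a| sqrt p - |b| sqrt r.\<close>

lemma psd2_iff: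
  "psd2 H \<longleftrightarrow> H$1$2 = H$2$1 \<and> 0 \<le> H$1$1 \<and> 0 \<le> H$2$2 \<and> 0 \<le> det H"
proof
  assume H: "psd2 H"
  then have "transpose H$1$2 = H$1$2" by (simp add: psd2_def)
  then have sym: "H$1$2 = H$2$1" by (simp add: transpose_def)
  have q: "0 \<le> a\<^sup>2 * H$1$1 + 2 * a * b * H$1$2 + b\<^sup>2 * H$2$2" for a b
    using H[unfolded psd2_def, THEN conjunct2, rule_format, of "vector [a, b]"] sym
    by (simp add: matrix2_simps vector_2 power2_eq_square algebra_simps)
  have 1: "0 \<le> H$1$1" "0 \<le> H$2$2"
    using q[of 1 0] q[of 0 1] by auto
  have "(H$1$2)\<^sup>2 \<le> H$1$1 * H$2$2"
  proof (cases "H$1$1 = 0")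
    case True
    have "H$1$2 = 0"
    proof (rule ccontr)
      assume h: "H$1$2 \<noteq> 0"
      \<comment> \<open>For p = 0 and b = 1 the form is affine in a; this a gives it the value
        -1.\<close>
      show False
        using q[of "- (H$2$2 + 1) / (2 * H$1$2)" 1] h True by (simp add: field_simps)
    qed
    then show ?thesis using True by simp
  next
    case False
    then have "0 < H$1$1" using 1 by simp
    \<comment> \<open>The form at (-q, p) equals p (p r - q^2).\<close>
    moreover have "0 \<le> H$1$1 * (H$1$1 * H$2$2 - (H$1$2)\<^sup>2)"
      using q[of "- H$1$2" "H$1$1"] by (simp add: power2_eq_square algebra_simps)
    ultimately show ?thesis by (simp add: zero_le_mult_iff)
  qed
  then show "H$1$2 = H$2$1 \<and> 0 \<le> H$1$1 \<and> 0 \<le> H$2$2 \<and> 0 \<le> det H"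
    using 1 sym by (simp add: det_2 power2_eq_square)
next
  assume H: "H$1$2 = H$2$1 \<and> 0 \<le> H$1$1 \<and> 0 \<le> H$2$2 \<and> 0 \<le> det H"
  have "0 \<le> x \<bullet> (H *v x)" for x
  proof -
    let ?p = "H$1$1" and ?q = "H$1$2" and ?r = "H$2$2"
    have sym: "H$2$1 = ?q" using H by simp
    have pq: "?q\<^sup>2 \<le> ?p * ?r" using H by (simp add: sym det_2 power2_eq_square)
    have "\<bar>?q\<bar> \<le> sqrt (?p * ?r)" using pq by (simp add: real_le_rsqrt)
    then have "\<bar>?q\<bar> \<le> sqrt ?p * sqrt ?r" by (simp add: real_sqrt_mult)
    then have "\<bar>x$1 * x$2\<bar> * \<bar>?q\<bar> \<le> \<bar>x$1 * x$2\<bar> * (sqrt ?p * sqrt ?r)"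
      by (rule mult_left_mono) simp
    moreover have "- (\<bar>x$1 * x$2\<bar> * \<bar>?q\<bar>) \<le> x$1 * x$2 * ?q"
      by (metis abs_ge_minus_self abs_mult minus_le_iff)
    moreover have "0 \<le> (\<bar>x$1\<bar> * sqrt ?p - \<bar>x$2\<bar> * sqrt ?r)\<^sup>2" by simp
    then have "2 * (\<bar>x$1 * x$2\<bar> * (sqrt ?p * sqrt ?r)) \<le> (x$1)\<^sup>2 * ?p + (x$2)\<^sup>2 * ?r"
      using H by (simp add: power2_diff power_mult_distrib abs_mult algebra_simps)
    ultimately have "0 \<le> (x$1)\<^sup>2 * ?p + 2 * (x$1 * x$2 * ?q) + (x$2)\<^sup>2 * ?r" by linarith
    then show ?thesis
      using H by (simp add: matrix2_simps power2_eq_square algebra_simps)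
  qed
  moreover have "transpose H = H" using H by (simp add: transpose_def vec_eq_iff forall_2)
  ultimately show "psd2 H" by (simp add: psd2_def)
qed

text \<open>Squaring gives det S = (det H)^2 and (trace H)^2 = trace S + 2 det H, and positivity
  selects the signs. Hence S alone determines both invariants of its root.\<close>

lemma psd2_square_root:
  assumes H: "psd2 H" and S: "H ** H = S" and pos: "det S > 0"
  shows "sqrt (det S) = det H" "sqrt (trace S + 2 * sqrt (det S)) = trace H"
    "det H > 0" "trace H > 0"
proof -
  have h: "H$1$2 = H$2$1" "0 \<le> H$1$1" "0 \<le> H$2$2" "0 \<le> det H"
    using H by (auto simp: psd2_iff)
  have dS: "det S = (det H)\<^sup>2" using S by (auto simp: det_mul power2_eq_square)
  then show "sqrt (det S) = det H" using h by simp
  have t: "trace S + 2 * det H = (trace H)\<^sup>2"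
    unfolding S[symmetric] using h(1)
    by (simp add: trace_2 matrix2_simps power2_eq_square algebra_simps)
  then show "sqrt (trace S + 2 * sqrt (det S)) = trace H"
    using h dS by (simp add: trace_2)
  show "det H > 0" using pos dS h(4) by (auto simp: le_less)
  then have "trace H \<noteq> 0" using h by (auto simp: trace_2 det_2 add_nonneg_eq_0_iff)
  then show "trace H > 0" using h by (auto simp: trace_2)
qed

text \<open>With t and d the trace and determinant of H, Cayley and Hamilton give H = (S + d 1) / t
  and the inverse (t 1 - H) / d; eliminating H by means of t^2 = trace S + 2 d yields the formula.
  It does not mention H, whence the uniqueness of the polar factor later on.\<close>

lemma inv_sqrt2_inverse:
  assumes "psd2 H" "H ** H = S" "det S > 0"
  shows "H ** inv_sqrt2 S = mat 1" "inv_sqrt2 S ** H = mat 1"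
proof -
  note r = psd2_square_root[OF assms]
  have *: "inv_sqrt2 S = (1 / (det H * trace H)) *\<^sub>R ((trace S + det H) *\<^sub>R mat 1 - S)"
    unfolding inv_sqrt2_def r(1) r(2)[unfolded r(1)] ..
  have "H ** ((trace S + det H) *\<^sub>R mat 1 - S) = (det H * trace H) *\<^sub>R mat 1"
  proof -
    have "H$1$2 = H$2$1" using assms(1) by (simp add: psd2_iff)
    then show ?thesis
      unfolding assms(2)[symmetric]
      by (simp add: matrix2_simps trace_2 algebra_simps)
  qed
  then show 1: "H ** inv_sqrt2 S = mat 1"
    unfolding * using r by (simp add: scalar_matrix_assoc[symmetric] matrix_scalar_ac)
  then show "inv_sqrt2 S ** H = mat 1"
    by (simp add: matrix_left_right_inverse)
qed

text \<open>Since S^2 = trace S * S - d^2 1, the square of S + d 1 is (trace S + 2 d) S = t^2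
  S.\<close>

lemma psd2_square_root_exists:
  fixes G :: "real^2^2"
  assumes "det G \<noteq> 0"
  shows "\<exists>H. psd2 H \<and> H ** H = transpose G ** G"
proof -
  define S where "S = transpose G ** G"
  define d where "d = sqrt (det S)"
  define t where "t = sqrt (trace S + 2 * d)"
  define H where "H = (1 / t) *\<^sub>R (S + d *\<^sub>R mat 1)"
  have dS: "det S > 0" using assms by (auto simp: S_def det_mul zero_less_mult_iff)
  then have d: "d > 0" "d\<^sup>2 = det S" by (auto simp: d_def)
  have S: "S$1$2 = S$2$1" "S$1$1 \<ge> 0" "S$2$2 \<ge> 0"
    by (auto simp: S_def matrix2_simps)
  then have "trace S + 2 * d > 0" using d by (simp add: trace_2)
  then have t: "t > 0" "t\<^sup>2 = trace S + 2 * d" by (auto simp: t_def)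
  have dd: "d * d = S$1$1 * S$2$2 - S$1$2 * S$1$2"
    using d(2) S(1) by (simp add: power2_eq_square det_2)
  have tt: "t * t = S$1$1 + S$2$2 + 2 * d" using t(2) by (simp add: trace_2 power2_eq_square)
  have "(S + d *\<^sub>R mat 1) ** (S + d *\<^sub>R mat 1) = (t * t) *\<^sub>R S"
    unfolding tt using S(1) by (simp add: matrix2_simps algebra_simps dd)
  then have "H ** H = S"
    using t(1) by (simp add: H_def scalar_matrix_assoc[symmetric] matrix_scalar_ac)
  moreover have "psd2 H"
  proof -
    have h: "H$1$2 = H$2$1" "0 \<le> H$1$1" "0 \<le> H$2$2"
      using S t d by (auto simp: H_def mat_def)
    have "t * t * det H = (S$1$1 + d) * (S$2$2 + d) - S$1$2 * S$2$1"
      using t(1) by (simp add: H_def det_2 mat_def field_simps)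
    also have "\<dots> = d * (2 * d + S$1$1 + S$2$2)"
      using dd S(1) by algebra
    also have "\<dots> \<ge> 0" using d S by simp
    finally have "0 \<le> det H" using t(1) by (meson mult_pos_pos zero_le_mult_iff not_le)
    then show ?thesis using h by (simp add: psd2_iff)
  qed
  ultimately show ?thesis unfolding S_def by blast
qed

text \<open>With E = H - 1 one has H^2 - 1 = E H + E. The cross term of E H and E is nonnegative,
  being the sum of the values of the form of H at the rows of E.\<close>

lemma norm_psd2_diff_one:
  assumes "psd2 H"
  shows "norm (H - mat 1) \<le> norm (H ** H - mat 1)"
proof -
  define E where "E = H - mat 1"
  have "H ** H - mat 1 = E ** H + E"
    by (simp add: E_def matrix2_simps algebra_simps)
  moreover have "0 \<le> (E ** H) \<bullet> E"
  proof -
    have h: "H *v x = x v* H" for x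
      using assms by (metis psd2_def transpose_matrix_vector)
    have "(E ** H) \<bullet> E = (\<Sum>i\<in>UNIV. (E$i) \<bullet> (H *v (E$i)))"
      unfolding h by (simp add: matrix2_simps algebra_simps)
    also have "\<dots> \<ge> 0" using assms by (intro sum_nonneg) (auto simp: psd2_def)
    finally show ?thesis .
  qed
  ultimately have "(norm E)\<^sup>2 \<le> (norm (H ** H - mat 1))\<^sup>2"
    by (simp add: power2_norm_eq_inner inner_add_left inner_add_right inner_commute)
  then show ?thesis by (simp add: E_def)
qed

lemma tendsto_matrix_mult [tendsto_intros]:
  fixes X Y :: "'b \<Rightarrow> real^2^2"
  assumes "(X \<longlongrightarrow> A) F" "(Y \<longlongrightarrow> B) F"
  shows "((\<lambda>x. X x ** Y x) \<longlongrightarrow> A ** B) F"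
  using assms unfolding matrix_matrix_mult_def
  by (intro tendsto_vec_lambda tendsto_sum tendsto_mult tendsto_vec_nth)

text \<open>Continuity is read off from the explicit formula; the sign conditions keep its
  denominator from vanishing in the limit.\<close>

lemma tendsto_inv_sqrt2:
  assumes "(X \<longlongrightarrow> S) F" "det S > 0" "trace S \<ge> 0"
  shows "((\<lambda>x. inv_sqrt2 (X x)) \<longlongrightarrow> inv_sqrt2 S) F"
proof -
  have "((\<lambda>x. det (X x)) \<longlongrightarrow> det S) F" "((\<lambda>x. trace (X x)) \<longlongrightarrow> trace S) F"
    unfolding det_2 trace_2 by (intro tendsto_intros assms(1))+
  moreover have "trace S + 2 * sqrt (det S) > 0"
    using assms(2,3) by (simp add: add_nonneg_pos)
  then have "sqrt (det S) * sqrt (trace S + 2 * sqrt (det S)) \<noteq> 0"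
    using assms(2) by simp
  ultimately show ?thesis
    unfolding inv_sqrt2_def using assms(1) by (intro tendsto_intros) auto
qed

subsection \<open>Finitely supported sequences\<close>

definition finsupp :: "(nat \<Rightarrow> 'a::zero) \<Rightarrow> bool" where
  "finsupp x \<longleftrightarrow> finite {i. x i \<noteq> 0}"

text \<open>For frames this is the Frobenius inner product.\<close>

definition ip :: "(nat \<Rightarrow> 'a::real_inner) \<Rightarrow> (nat \<Rightarrow> 'a) \<Rightarrow> real" where
  "ip x y = Sum_any (\<lambda>i. x i \<bullet> y i)"

lemma inner_inf_eq_ip: "inner_inf = ip"
  by (simp add: fun_eq_iff inner_inf_def ip_def)

lemma R_inf_iff [simp]: "x \<in> R_inf \<longleftrightarrow> finsupp x"
  by (simp add: R_inf_def finsupp_def)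

lemma finsuppI: "finite K \<Longrightarrow> (\<And>i. i \<notin> K \<Longrightarrow> x i = 0) \<Longrightarrow> finsupp x"
  unfolding finsupp_def by (rule finite_subset[of _ K]) auto

lemma finsupp_superset:
  assumes "finsupp x" "finsupp y"
  obtains K where "finite K" "\<And>i. i \<notin> K \<Longrightarrow> x i = 0" "\<And>i. i \<notin> K \<Longrightarrow> y i = 0"
  using assms unfolding finsupp_def
  by (intro that[of "{i. x i \<noteq> 0} \<union> {i. y i \<noteq> 0}"]) auto

lemma finsupp_map: "finsupp x \<Longrightarrow> f 0 = 0 \<Longrightarrow> finsupp (\<lambda>i. f (x i))"
  unfolding finsupp_def by (erule rev_finite_subset) auto

lemma finsupp_add [simp]: "finsupp x \<Longrightarrow> finsupp y \<Longrightarrow> finsupp (\<lambda>i. x i + y i)"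
  for x y :: "nat \<Rightarrow> 'a::monoid_add"
  by (erule (1) finsupp_superset) (erule finsuppI, simp)

lemma finsupp_diff [simp]: "finsupp x \<Longrightarrow> finsupp y \<Longrightarrow> finsupp (\<lambda>i. x i - y i)"
  for x y :: "nat \<Rightarrow> 'a::group_add"
  by (erule (1) finsupp_superset) (erule finsuppI, simp)

lemma finsupp_scaleR [simp]: "finsupp x \<Longrightarrow> finsupp (\<lambda>i. c *\<^sub>R x i)"
  for x :: "nat \<Rightarrow> 'a::real_vector"
  by (rule finsupp_map) auto

lemma ip_eq_sum:
  assumes "finite K" "\<And>i. i \<notin> K \<Longrightarrow> x i = 0 \<or> y i = 0"
  shows "ip x y = (\<Sum>i\<in>K. x i \<bullet> y i)"
proof -
  have "x i \<bullet> y i = 0" if "i \<notin> K" for i using assms(2)[OF that] by auto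
  then show ?thesis
    unfolding ip_def using assms(1) by (intro Sum_any.expand_superset) auto
qed


lemma ip_commute: "ip x y = ip y x"
  by (simp add: ip_def inner_commute)

lemma ip_add_left [simp]: "finsupp z \<Longrightarrow> ip (\<lambda>i. x i + y i) z = ip x z + ip y z"
  using ip_eq_sum[of "{i. z i \<noteq> 0}" _ z]
  by (simp add: finsupp_def inner_add_left sum.distrib)

lemma ip_diff_left [simp]: "finsupp z \<Longrightarrow> ip (\<lambda>i. x i - y i) z = ip x z - ip y z"
  using ip_eq_sum[of "{i. z i \<noteq> 0}" _ z]
  by (simp add: finsupp_def inner_diff_left sum_subtractf)

lemma ip_scaleR_left [simp]: "finsupp z \<Longrightarrow> ip (\<lambda>i. c *\<^sub>R x i) z = c * ip x z"
  using ip_eq_sum[of "{i. z i \<noteq> 0}" _ z]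
  by (simp add: finsupp_def sum_distrib_left)

lemma ip_add_right [simp]: "finsupp z \<Longrightarrow> ip z (\<lambda>i. x i + y i) = ip z x + ip z y"
  by (simp add: ip_commute[of z])

lemma ip_diff_right [simp]: "finsupp z \<Longrightarrow> ip z (\<lambda>i. x i - y i) = ip z x - ip z y"
  by (simp add: ip_commute[of z])

lemma ip_scaleR_right [simp]: "finsupp z \<Longrightarrow> ip z (\<lambda>i. c *\<^sub>R x i) = c * ip z x"
  by (simp add: ip_commute[of z])

lemma ip_ge_0 [simp]: "0 \<le> ip x x"
  unfolding ip_def Sum_any.expand_set by (simp add: sum_nonneg)

lemma ip_eq_0_iff:
  assumes "finsupp x"
  shows "ip x x = 0 \<longleftrightarrow> x = (\<lambda>i. 0)"
proof -
  have "ip x x = (\<Sum>i | x i \<noteq> 0. x i \<bullet> x i)"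
    using assms by (intro ip_eq_sum) (auto simp: finsupp_def)
  then show ?thesis
    using assms by (auto simp: finsupp_def sum_nonneg_eq_0_iff fun_eq_iff)
qed

subsection \<open>Symmetric matrices and the Rayleigh quotient\<close>

text \<open>Confining the matrix to the blocks in K reduces everything to finite dimension. Only
  rows outside K are asked to vanish; the columns follow by symmetry.\<close>

definition symmetric_on :: "nat set \<Rightarrow> inf_mat \<Rightarrow> bool" where
  "symmetric_on K A \<longleftrightarrow> (\<forall>i k. A k i = transpose (A i k)) \<and> (\<forall>i k. i \<notin> K \<longrightarrow> A i k = 0)"

lemma symmetric_on_mono: "symmetric_on K A \<Longrightarrow> K \<subseteq> L \<Longrightarrow> symmetric_on L A"
  unfolding symmetric_on_def by blast

lemma symmetric_on_outside:
  assumes "symmetric_on K A" "i \<notin> K \<or> k \<notin> K"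
  shows "A i k = 0"
proof -
  have "transpose (0::real^2^2) = 0" by (simp add: transpose_def vec_eq_iff)
  then show ?thesis using assms by (metis symmetric_on_def)
qed

lemma mat_vec_inf_eq_sum:
  assumes "finite K" "symmetric_on K A"
  shows "mat_vec_inf A x i = (\<Sum>k\<in>K. A i k *v x k)"
proof -
  have "A i k *v x k = 0" if "k \<notin> K" for k
    using symmetric_on_outside[OF assms(2), of i k] that by simp
  then show ?thesis
    unfolding mat_vec_inf_def using assms(1) by (intro Sum_any.expand_superset) auto
qed

context
  fixes K A
  assumes fin: "finite K" and sym: "symmetric_on K A"
begin

lemma mat_vec_inf_outside: "i \<notin> K \<Longrightarrow> mat_vec_inf A x i = 0"
  by (simp add: mat_vec_inf_eq_sum[OF fin sym] symmetric_on_outside[OF sym])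

lemma finsupp_mat_vec_inf [simp]: "finsupp (mat_vec_inf A x)"
  using fin mat_vec_inf_outside by (rule finsuppI)

lemma mat_vec_inf_linear:
  "mat_vec_inf A (\<lambda>i. x i + y i) = (\<lambda>i. mat_vec_inf A x i + mat_vec_inf A y i)"
  "mat_vec_inf A (\<lambda>i. x i - y i) = (\<lambda>i. mat_vec_inf A x i - mat_vec_inf A y i)"
  "mat_vec_inf A (\<lambda>i. c *\<^sub>R x i) = (\<lambda>i. c *\<^sub>R mat_vec_inf A x i)"
  by (simp_all add: fun_eq_iff mat_vec_inf_eq_sum[OF fin sym] matrix_vector_right_distrib
      matrix_vector_mult_diff_distrib matrix_vector_mult_scaleR sum.distrib sum_subtractf
      scaleR_sum_right)

lemma ip_mat_vec_inf_eq_sum: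
  "ip (mat_vec_inf A x) y = (\<Sum>i\<in>K. \<Sum>k\<in>K. (A i k *v x k) \<bullet> y i)"
proof -
  have "ip (mat_vec_inf A x) y = (\<Sum>i\<in>K. mat_vec_inf A x i \<bullet> y i)"
    using fin by (intro ip_eq_sum) (simp_all add: mat_vec_inf_outside)
  then show ?thesis by (simp add: mat_vec_inf_eq_sum[OF fin sym] inner_sum_left)
qed

lemma ip_mat_vec_inf_commute: "ip (mat_vec_inf A x) y = ip x (mat_vec_inf A y)"
proof -
  have "(A i k *v x k) \<bullet> y i = (A k i *v y i) \<bullet> x k" for i k
  proof -
    have "A k i = transpose (A i k)" using sym unfolding symmetric_on_def by blast
    then have "(A k i *v y i) \<bullet> x k = y i \<bullet> (A i k *v x k)"
      by (simp only: transpose_matrix_vector dot_lmul_matrix)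
    then show ?thesis by (simp only: inner_commute)
  qed
  then have "ip (mat_vec_inf A x) y = (\<Sum>i\<in>K. \<Sum>k\<in>K. (A k i *v y i) \<bullet> x k)"
    by (simp only: ip_mat_vec_inf_eq_sum)
  also have "\<dots> = ip (mat_vec_inf A y) x"
    unfolding ip_mat_vec_inf_eq_sum by (rule sum.swap)
  finally show ?thesis by (simp only: ip_commute)
qed

text \<open>The quotient attains its maximum on the unit sphere of the vectors supported in K and
  orthogonal to N. This space is invariant under A because N consists of eigenvectors, so a
  maximiser is an eigenvector. The vector \<open>x0\<close> ensures that the sphere is
  nonempty.\<close>

lemma rayleigh_maximum:
  assumes N: "\<And>n. n \<in> N \<Longrightarrow> \<exists>c. eigenvector_inf A c n"
    and x0: "\<And>i. i \<notin> K \<Longrightarrow> x0 i = 0" "\<And>n. n \<in> N \<Longrightarrow> ip x0 n = 0" "x0 \<noteq> (\<lambda>i. 0)"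
  obtains x s where "\<And>i. i \<notin> K \<Longrightarrow> x i = 0" "\<And>n. n \<in> N \<Longrightarrow> ip x n = 0" "ip x x = 1"
    "eigenvector_inf A s x"
    "\<And>y. (\<And>i. i \<notin> K \<Longrightarrow> y i = 0) \<Longrightarrow> (\<And>n. n \<in> N \<Longrightarrow> ip y n = 0) \<Longrightarrow>
       ip (mat_vec_inf A y) y \<le> s * ip y y"
proof -
  define S where "S = {x::inf_vec. (\<forall>i. i \<notin> K \<longrightarrow> x i = 0) \<and> (\<forall>n\<in>N. ip x n = 0)}"
  have S_fin: "finsupp x" if "x \<in> S" for x
    using that fin by (auto simp: S_def intro: finsuppI)
  have N_fin: "finsupp n" if "n \<in> N" for n
    using N[OF that] by (auto simp: eigenvector_inf_def)
  have S_sum: "ip x y = (\<Sum>i\<in>K. x i \<bullet> y i)" if "x \<in> S" for x y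
    using that fin by (intro ip_eq_sum) (auto simp: S_def)
  define q where "q y = ip (mat_vec_inf A y) y" for y
  define sphere where "sphere = {x \<in> S. ip x x = 1}"
  \<comment> \<open>Sequences carry the product topology, so compactness comes from Tychonoff: the
    sphere is a closed subset of this product of discs and points.\<close>
  define cube where "cube = PiE UNIV (\<lambda>i. if i \<in> K then cball (0::real^2) 1 else {0})"
  have S_add: "(\<lambda>i. x i + t *\<^sub>R y i) \<in> S" if "x \<in> S" "y \<in> S" for x y t
    using that N_fin by (auto simp: S_def)
  have S_scale: "(\<lambda>i. t *\<^sub>R y i) \<in> S" if "y \<in> S" for y t
    using that N_fin by (auto simp: S_def)
  have "compactin (product_topology (\<lambda>i. euclidean) UNIV) cube"
    unfolding cube_def by (subst compactin_PiE) auto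
  then have "compact cube"
    by (simp add: euclidean_product_topology)
  moreover have "closed {x::inf_vec. (\<Sum>i\<in>K. x i \<bullet> x i) = 1}"
    by (intro closed_Collect_eq continuous_intros) auto
  moreover have "closed (\<Inter>n\<in>N. {x::inf_vec. (\<Sum>i\<in>K. x i \<bullet> n i) = 0})"
    by (intro closed_INT ballI closed_Collect_eq continuous_intros) auto
  moreover have "sphere = cube \<inter> {x. (\<Sum>i\<in>K. x i \<bullet> x i) = 1} \<inter>
      (\<Inter>n\<in>N. {x. (\<Sum>i\<in>K. x i \<bullet> n i) = 0})" (is "_ = ?R")
  proof
    show "sphere \<subseteq> ?R"
    proof
      fix x assume x: "x \<in> sphere"
      then have xS: "x \<in> S" and 1: "(\<Sum>i\<in>K. x i \<bullet> x i) = 1"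
        by (auto simp: sphere_def S_sum)
      have "norm (x i) \<le> 1" if "i \<in> K" for i
      proof -
        have "x i \<bullet> x i \<le> (\<Sum>i\<in>K. x i \<bullet> x i)"
          using fin that by (intro member_le_sum) auto
        then show ?thesis using 1 by (simp add: norm_eq_sqrt_inner)
      qed
      then have "x \<in> cube" using xS by (auto simp: cube_def S_def)
      moreover have "(\<Sum>i\<in>K. x i \<bullet> n i) = 0" if "n \<in> N" for n
        using that xS S_sum[OF xS, of n] by (auto simp: S_def)
      ultimately show "x \<in> ?R" using 1 by auto
    qed
    show "?R \<subseteq> sphere"
    proof
      fix x assume x: "x \<in> ?R"
      have out: "x i = 0" if "i \<notin> K" for i
      proof -
        have "x i \<in> (if i \<in> K then cball (0::real^2) 1 else {0})"
          using x by (auto simp: cube_def PiE_def Pi_def)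
        then show ?thesis using that by simp
      qed
      then have "ip x y = (\<Sum>i\<in>K. x i \<bullet> y i)" for y
        using fin by (intro ip_eq_sum) auto
      then show "x \<in> sphere" using x out by (auto simp: sphere_def S_def)
    qed
  qed
  ultimately have "compact sphere" by (simp add: compact_Int_closed)
  moreover have "sphere \<noteq> {}"
  proof -
    have x0S: "x0 \<in> S" using x0 by (auto simp: S_def)
    then have p: "ip x0 x0 > 0"
      using S_fin[OF x0S] x0(3) ip_eq_0_iff[of x0] by (simp add: less_le)
    then have "(\<lambda>i. (1 / sqrt (ip x0 x0)) *\<^sub>R x0 i) \<in> sphere"
      using S_fin[OF x0S] S_scale[OF x0S] by (simp add: sphere_def)
    then show ?thesis by blast
  qed
  moreover have "continuous_on sphere q"
  proof -
    have "continuous_on sphere (\<lambda>x. A i k *v x k)" for i k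
      by (rule continuous_on_compose2[of UNIV "\<lambda>z. A i k *v z"])
         (auto intro!: linear_continuous_on matrix_vector_mul_bounded_linear
           continuous_on_subset[OF continuous_on_product_coordinates])
    moreover have "continuous_on sphere (\<lambda>x::inf_vec. x i)" for i
      by (rule continuous_on_subset[OF continuous_on_product_coordinates]) simp
    ultimately show ?thesis
      unfolding q_def ip_mat_vec_inf_eq_sum by (intro continuous_intros)
  qed
  ultimately obtain x where x: "x \<in> sphere" and max: "\<And>y. y \<in> sphere \<Longrightarrow> q y \<le> q x"
    using continuous_attains_sup by metis
  define s where "s = q x"
  have xS: "x \<in> S" and x1: "ip x x = 1" using x by (auto simp: sphere_def)
  note xf = S_fin[OF xS]
  have bound: "q y \<le> s * ip y y" if y: "y \<in> S" for y
  proof (cases "ip y y = 0")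
    case True
    then have "y = (\<lambda>i. 0)" using ip_eq_0_iff[OF S_fin[OF y]] by simp
    then show ?thesis using True by (simp add: q_def ip_def)
  next
    case False
    then have p: "ip y y > 0" by (simp add: less_le)
    define z where "z = (\<lambda>i. (1 / sqrt (ip y y)) *\<^sub>R y i)"
    have "z \<in> sphere"
      using p S_fin[OF y] S_scale[OF y] by (simp add: sphere_def z_def)
    moreover have "q z = q y / ip y y"
      using p S_fin[OF y] by (simp add: q_def z_def mat_vec_inf_linear)
    ultimately have "q y / ip y y \<le> s" using max[of z] by (simp add: s_def)
    then show ?thesis using p by (simp add: field_simps)
  qed
  \<comment> \<open>The defect in the eigenvector equation. It is an admissible direction of
    variation, so maximality at x can be tested along it.\<close>
  define g where "g = (\<lambda>i. s *\<^sub>R x i - mat_vec_inf A x i)"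
  have gf: "finsupp g" using xf by (simp add: g_def)
  have gS: "g \<in> S"
  proof -
    have "ip g n = 0" if n: "n \<in> N" for n
    proof -
      obtain c where "eigenvector_inf A c n" using N[OF n] by blast
      then have "mat_vec_inf A n = (\<lambda>i. c *\<^sub>R n i)" by (simp add: eigenvector_inf_def)
      moreover have "ip x n = 0" using xS n by (auto simp: S_def)
      ultimately show ?thesis
        using N_fin[OF n] xf by (simp add: g_def ip_mat_vec_inf_commute)
    qed
    moreover have "g i = 0" if "i \<notin> K" for i
      using xS that mat_vec_inf_outside by (simp add: g_def S_def)
    ultimately show ?thesis by (simp add: S_def)
  qed
  text \<open>The nonnegative form \<open>s |y|\<^sup>2 - q y\<close> vanishes at \<open>x\<close>, hence so does its derivative.\<close>
  define a where "a = s * ip g g - q g"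
  have "a \<ge> 0" using bound[OF gS] by (simp add: a_def)
  have "0 \<le> 2 * t * ip g g + t\<^sup>2 * a" for t
  proof -
    let ?y = "\<lambda>i. x i + t *\<^sub>R g i"
    have "q ?y = q x + 2 * t * ip (mat_vec_inf A x) g + t\<^sup>2 * q g"
      using xf gf by (simp add: q_def mat_vec_inf_linear ip_mat_vec_inf_commute[of g x]
          ip_commute[of g] power2_eq_square algebra_simps)
    moreover have "ip ?y ?y = 1 + 2 * t * ip x g + t\<^sup>2 * ip g g"
      using xf gf x1 by (simp add: ip_commute[of g x] power2_eq_square algebra_simps)
    moreover have "ip g g = s * ip x g - ip (mat_vec_inf A x) g"
      using gf by (subst (1) g_def) simp
    then have "2 * t * ip g g = s * (2 * t * ip x g) - 2 * t * ip (mat_vec_inf A x) g"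
      by algebra
    moreover have "t\<^sup>2 * a = s * (t\<^sup>2 * ip g g) - t\<^sup>2 * q g"
      by (simp add: a_def algebra_simps)
    moreover note bound[OF S_add[OF xS gS, of t]]
    ultimately show ?thesis
      unfolding s_def[symmetric] by (simp add: distrib_left)
  qed
  note nonneg = this
  \<comment> \<open>At t = -u the nonnegative expression becomes -u^2 (a + 2). Dividing by a + 1
    rather than a covers the case a = 0.\<close>
  define u where "u = ip g g / (a + 1)"
  have gu: "ip g g = u * (a + 1)" using \<open>a \<ge> 0\<close> by (simp add: u_def)
  have "2 * - u * ip g g + (- u)\<^sup>2 * a = - (u\<^sup>2 * (a + 2))"
    unfolding gu by (simp add: power2_eq_square algebra_simps)
  then have "u\<^sup>2 * (a + 2) \<le> 0" using nonneg[of "- u"] by linarith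
  then have "u = 0" using \<open>a \<ge> 0\<close> by (auto simp: mult_le_0_iff)
  then have "ip g g = 0" by (simp add: gu)
  then have "g = (\<lambda>i. 0)" using ip_eq_0_iff[OF gf] by simp
  then have "mat_vec_inf A x = (\<lambda>i. s *\<^sub>R x i)"
    by (simp add: g_def fun_eq_iff)
  moreover have "x \<noteq> (\<lambda>i. 0)" using x1 by (auto simp: ip_def)
  ultimately have "eigenvector_inf A s x" using xf by (simp add: eigenvector_inf_def)
  then show thesis
    using that[of x s] xS x1 bound by (auto simp: S_def q_def)
qed

end

section \<open>Bessel inequalities and the two top eigenvectors\<close>

definition orthonormal2 :: "inf_vec \<Rightarrow> inf_vec \<Rightarrow> bool" where
  "orthonormal2 v w \<longleftrightarrow> finsupp v \<and> finsupp w \<and> ip v v = 1 \<and> ip w w = 1 \<and> ip v w = 0"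

lemma top_eigenvectors_orthonormal2: "top_eigenvectors A v w \<Longrightarrow> orthonormal2 v w"
  by (auto simp: top_eigenvectors_def orthonormal2_def eigenvector_inf_def inner_inf_eq_ip)

text \<open>The difference of the two sides is the squared length of what remains of q after
  removing its three orthonormal components.\<close>

lemma bessel3:
  assumes "orthonormal2 v w" "finsupp x" "ip x x = 1" "ip x v = 0" "ip x w = 0" "finsupp q"
  shows "(ip q v)\<^sup>2 + (ip q w)\<^sup>2 + (ip q x)\<^sup>2 \<le> ip q q"
proof -
  let ?z = "\<lambda>i. ((q i - ip q v *\<^sub>R v i) - ip q w *\<^sub>R w i) - ip q x *\<^sub>R x i"
  have "ip ?z ?z = ip q q - (ip q v)\<^sup>2 - (ip q w)\<^sup>2 - (ip q x)\<^sup>2"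
    using assms unfolding orthonormal2_def
    by (simp add: ip_commute[of v q] ip_commute[of w q] ip_commute[of x q] ip_commute[of w v]
        ip_commute[of v x] ip_commute[of w x] power2_eq_square algebra_simps)
  then show ?thesis using ip_ge_0[of ?z] by linarith
qed

lemma bessel2:
  assumes "orthonormal2 v w" "finsupp q"
  shows "(ip q v)\<^sup>2 + (ip q w)\<^sup>2 \<le> ip q q"
proof -
  let ?z = "\<lambda>i. (q i - ip q v *\<^sub>R v i) - ip q w *\<^sub>R w i"
  have "ip ?z ?z = ip q q - (ip q v)\<^sup>2 - (ip q w)\<^sup>2"
    using assms unfolding orthonormal2_def
    by (simp add: ip_commute[of v q] ip_commute[of w q] ip_commute[of w v]
        power2_eq_square algebra_simps)
  then show ?thesis using ip_ge_0[of ?z] by linarith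
qed

context
  fixes K A
  assumes fin: "finite K" and sym: "symmetric_on K A"
begin

text \<open>Two successive Rayleigh maximisations: v on all vectors supported in K, then w on those
  orthogonal to v.\<close>

lemma top_eigenvectors_exist:
  assumes "K \<noteq> {}" and psd: "\<And>x. finsupp x \<Longrightarrow> 0 \<le> ip (mat_vec_inf A x) x"
  shows "\<exists>v w. top_eigenvectors A v w"
proof -
  obtain j where j: "j \<in> K" using assms(1) by blast
  define e where "e r = (\<lambda>i. if i = j then axis r (1::real) else (0::real^2))" for r :: 2
  have e_fin: "finsupp (e r)" for r
    by (rule finsuppI[of "{j}"]) (auto simp: e_def)
  have e_out: "e r i = 0" if "i \<notin> K" for r i using that j by (auto simp: e_def)
  have e_nz: "e 1 \<noteq> (\<lambda>i. 0)" by (auto simp: e_def fun_eq_iff axis_eq_0_iff)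
  obtain v c where v: "\<And>i. i \<notin> K \<Longrightarrow> v i = 0" "ip v v = 1" "eigenvector_inf A c v"
    "\<And>y. (\<And>i. i \<notin> K \<Longrightarrow> y i = 0) \<Longrightarrow> ip (mat_vec_inf A y) y \<le> c * ip y y"
    by (rule rayleigh_maximum[OF fin sym, of "{}" "e 1"]) (use e_out e_nz in auto)
  have vf: "finsupp v" using v(3) by (simp add: eigenvector_inf_def)
  \<comment> \<open>The two unit vectors of a single block span a plane, which contains a nonzero
    vector orthogonal to v; it starts the second maximisation.\<close>
  define x0 where "x0 = (if ip (e 1) v = 0 then e 1
    else (\<lambda>i. ip (e 1) v *\<^sub>R e 2 i - ip (e 2) v *\<^sub>R e 1 i))"
  have x0_out: "x0 i = 0" if "i \<notin> K" for i using e_out that by (auto simp: x0_def)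
  have x0_v: "ip x0 v = 0" using vf by (simp add: x0_def)
  have x0_nz: "x0 \<noteq> (\<lambda>i. 0)"
  proof
    assume 0: "x0 = (\<lambda>i. 0)"
    then have "x0 j $ 2 = 0" by simp
    then have "ip (e 1) v = 0" by (simp add: x0_def e_def axis_def split: if_splits)
    then show False using 0 e_nz by (simp add: x0_def)
  qed
  obtain w d where w: "\<And>i. i \<notin> K \<Longrightarrow> w i = 0" "ip w v = 0" "ip w w = 1" "eigenvector_inf A d w"
    "\<And>y. (\<And>i. i \<notin> K \<Longrightarrow> y i = 0) \<Longrightarrow> ip y v = 0 \<Longrightarrow> ip (mat_vec_inf A y) y \<le> d * ip y y"
    by (rule rayleigh_maximum[OF fin sym, of "{v}" x0]) (use x0_out x0_v x0_nz v(3) in auto)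
  have wf: "finsupp w" using w(4) by (simp add: eigenvector_inf_def)
  have c0: "c \<ge> 0" using psd[OF vf] v(2,3) vf by (simp add: eigenvector_inf_def)
  have d0: "d \<ge> 0" using psd[OF wf] w(3,4) wf by (simp add: eigenvector_inf_def)
  \<comment> \<open>An eigenvector with s > 0 is supported in K, because A x is, so both maxima
    bound s. If s <= 0, positivity of A suffices.\<close>
  have "s \<le> c \<and> s \<le> d" if x: "eigenvector_inf A s x" and xv: "ip x v = 0" for s x
  proof (cases "s \<le> 0")
    case True
    then show ?thesis using c0 d0 by simp
  next
    case False
    have xf: "finsupp x" and Ax: "mat_vec_inf A x = (\<lambda>i. s *\<^sub>R x i)" and nz: "x \<noteq> (\<lambda>i. 0)"
      using x by (auto simp: eigenvector_inf_def)
    have out: "x i = 0" if "i \<notin> K" for i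
      using mat_vec_inf_outside[OF fin sym that, of x] Ax False by simp
    have "ip x x > 0" using ip_eq_0_iff[OF xf] nz by (simp add: less_le)
    moreover have "ip (mat_vec_inf A x) x = s * ip x x" using xf by (simp add: Ax)
    ultimately show ?thesis using v(4)[of x] w(5)[of x] out xv by simp
  qed
  then have "top_eigenvectors A v w"
    unfolding top_eigenvectors_def inner_inf_eq_ip
    using v(2,3) w(2,3,4) ip_commute[of v w] by auto
  then show ?thesis by blast
qed

text \<open>Split q into its components along v and w and the rest y. The cross terms vanish because
  A preserves the span of v and w, and the hypothesis bounds the form at y.\<close>

lemma eigenvector_pair_bound:
  assumes vw: "orthonormal2 v w" and v: "eigenvector_inf A c v" and w: "eigenvector_inf A d w"
    and bound: "\<And>y. finsupp y \<Longrightarrow> ip y v = 0 \<Longrightarrow> ip y w = 0 \<Longrightarrow>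
      ip (mat_vec_inf A y) y \<le> s * ip y y"
    and q: "finsupp q"
  shows "ip (mat_vec_inf A q) q \<le> c * (ip q v)\<^sup>2 + d * (ip q w)\<^sup>2 +
    s * (ip q q - (ip q v)\<^sup>2 - (ip q w)\<^sup>2)"
proof -
  let ?y = "\<lambda>i. (q i - ip q v *\<^sub>R v i) - ip q w *\<^sub>R w i"
  have o: "finsupp v" "finsupp w" "ip v v = 1" "ip w w = 1" "ip v w = 0" "ip w v = 0"
    using vw ip_commute[of w v] by (auto simp: orthonormal2_def)
  have A: "mat_vec_inf A v = (\<lambda>i. c *\<^sub>R v i)" "mat_vec_inf A w = (\<lambda>i. d *\<^sub>R w i)"
    using v w by (auto simp: eigenvector_inf_def)
  have 1: "ip (mat_vec_inf A q) v = c * ip q v" "ip (mat_vec_inf A q) w = d * ip q w"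
    using o q by (simp_all add: ip_mat_vec_inf_commute[OF fin sym] A)
  have "ip ?y v = 0" "ip ?y w = 0" "finsupp ?y" using o q by simp_all
  then have "ip (mat_vec_inf A ?y) ?y \<le> s * ip ?y ?y" by (rule bound[rotated 1])
  moreover have "ip ?y ?y = ip q q - (ip q v)\<^sup>2 - (ip q w)\<^sup>2"
    using o q by (simp add: ip_commute[of v q] ip_commute[of w q] power2_eq_square algebra_simps)
  moreover have "ip (mat_vec_inf A ?y) ?y
      = ip (mat_vec_inf A q) q - c * (ip q v)\<^sup>2 - d * (ip q w)\<^sup>2"
    using o q by (simp add: mat_vec_inf_linear[OF fin sym] A 1 finsupp_mat_vec_inf[OF fin sym]
        ip_commute[of v q] ip_commute[of w q] power2_eq_square algebra_simps)
  ultimately show ?thesis by simp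
qed

text \<open>The trace bound makes 2 - c - d an upper bound for the form on the complement of v and
  w. The pair p forces c + d >= 2 - \<delta>, and c, d <= 1, so both are at least 1 - \<delta> while
  the complement contributes at most \<delta>: the gap is 1 - 2 \<delta>.\<close>

lemma spectral_gap:
  assumes top: "top_eigenvectors A v w"
    and le1: "\<And>x. finsupp x \<Longrightarrow> ip (mat_vec_inf A x) x \<le> ip x x"
    and tr: "\<And>x y z. orthonormal2 x y \<Longrightarrow> finsupp z \<Longrightarrow> ip z z = 1 \<Longrightarrow> ip z x = 0 \<Longrightarrow>
      ip z y = 0 \<Longrightarrow> ip (mat_vec_inf A x) x + ip (mat_vec_inf A y) y + ip (mat_vec_inf A z) z \<le> 2"
    and p: "orthonormal2 p1 p2" "2 - \<delta> \<le> ip (mat_vec_inf A p1) p1 + ip (mat_vec_inf A p2) p2"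
    and q: "orthonormal2 q1 q2"
  shows "(1 - 2 * \<delta>) * (2 - ((ip q1 v)\<^sup>2 + (ip q1 w)\<^sup>2 + (ip q2 v)\<^sup>2 + (ip q2 w)\<^sup>2)) \<le>
    ip (mat_vec_inf A v) v + ip (mat_vec_inf A w) w
      - ip (mat_vec_inf A q1) q1 - ip (mat_vec_inf A q2) q2"
proof -
  have vw: "orthonormal2 v w" using top by (rule top_eigenvectors_orthonormal2)
  then have o: "finsupp v" "finsupp w" "ip v v = 1" "ip w w = 1" by (auto simp: orthonormal2_def)
  obtain c d where cd: "eigenvector_inf A c v" "eigenvector_inf A d w"
    and max: "\<And>s x. eigenvector_inf A s x \<Longrightarrow> ip x v = 0 \<Longrightarrow> ip x w = 0 \<Longrightarrow> s \<le> c \<and> s \<le> d"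
    using top by (auto simp: top_eigenvectors_def inner_inf_eq_ip)
  have c: "ip (mat_vec_inf A v) v = c" and d: "ip (mat_vec_inf A w) w = d"
    using cd o by (auto simp: eigenvector_inf_def)
  have bound: "ip (mat_vec_inf A y) y \<le> c * ip y y" "ip (mat_vec_inf A y) y \<le> d * ip y y"
    "ip (mat_vec_inf A y) y \<le> (2 - c - d) * ip y y"
    if y: "finsupp y" "ip y v = 0" "ip y w = 0" for y
  proof -
    have "ip (mat_vec_inf A y) y \<le> c * ip y y \<and> ip (mat_vec_inf A y) y \<le> d * ip y y \<and>
      ip (mat_vec_inf A y) y \<le> (2 - c - d) * ip y y"
    proof (cases "y = (\<lambda>i. 0)")
      case True
      then show ?thesis by (simp add: ip_def)
    next
      case False
      \<comment> \<open>A vector y may leave K, so the maximisation is run on an index set enlarged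
        by its support.\<close>
      define L where "L = K \<union> {i. y i \<noteq> 0}"
      have L: "finite L" "symmetric_on L A"
        using fin y symmetric_on_mono[OF sym, of L] by (auto simp: L_def finsupp_def)
      obtain x s where x: "\<And>n. n \<in> {v, w} \<Longrightarrow> ip x n = 0" "ip x x = 1" "eigenvector_inf A s x"
        and m: "\<And>z. (\<And>i. i \<notin> L \<Longrightarrow> z i = 0) \<Longrightarrow> (\<And>n. n \<in> {v, w} \<Longrightarrow> ip z n = 0) \<Longrightarrow>
            ip (mat_vec_inf A z) z \<le> s * ip z z"
        by (rule rayleigh_maximum[OF L, of "{v, w}" y]) (use y False cd in \<open>auto simp: L_def\<close>)
      have xf: "finsupp x" using x(3) by (simp add: eigenvector_inf_def)
      have "s \<le> c" "s \<le> d" using max x by auto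
      moreover have "ip (mat_vec_inf A x) x = s" using x xf by (simp add: eigenvector_inf_def)
      then have "s \<le> 2 - c - d" using tr[OF vw xf] x c d by simp
      moreover have "ip (mat_vec_inf A y) y \<le> s * ip y y" using y by (intro m) (auto simp: L_def)
      ultimately show ?thesis
        using mult_right_mono[OF _ ip_ge_0[of y]] by (meson order_trans)
    qed
    then show "ip (mat_vec_inf A y) y \<le> c * ip y y" "ip (mat_vec_inf A y) y \<le> d * ip y y"
      "ip (mat_vec_inf A y) y \<le> (2 - c - d) * ip y y" by auto
  qed
  \<comment> \<open>\<open>\<alpha>\<close> and \<open>\<beta>\<close> are the squared lengths of
    the projections of v and w to the plane of the pair, hence at most 1 by Bessel.\<close>
  define \<alpha> where "\<alpha> r1 r2 = (ip r1 v)\<^sup>2 + (ip r2 v)\<^sup>2" for r1 r2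
  define \<beta> where "\<beta> r1 r2 = (ip r1 w)\<^sup>2 + (ip r2 w)\<^sup>2" for r1 r2
  have le: "\<alpha> r1 r2 \<le> 1" "\<beta> r1 r2 \<le> 1" if "orthonormal2 r1 r2" for r1 r2
    using bessel2[OF that, of v] bessel2[OF that, of w] o
    by (simp_all add: \<alpha>_def \<beta>_def ip_commute[of r1] ip_commute[of r2])
  have pair: "ip (mat_vec_inf A r1) r1 + ip (mat_vec_inf A r2) r2 \<le>
      c * \<alpha> r1 r2 + d * \<beta> r1 r2 + s * (2 - \<alpha> r1 r2 - \<beta> r1 r2)"
    if r: "orthonormal2 r1 r2" and b: "\<And>y. finsupp y \<Longrightarrow> ip y v = 0 \<Longrightarrow> ip y w = 0 \<Longrightarrow>
      ip (mat_vec_inf A y) y \<le> s * ip y y" for r1 r2 s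
  proof -
    have "finsupp r1" "finsupp r2" "ip r1 r1 = 1" "ip r2 r2 = 1"
      using r by (auto simp: orthonormal2_def)
    moreover have "ip (mat_vec_inf A r) r \<le> c * (ip r v)\<^sup>2 + d * (ip r w)\<^sup>2 +
        s * (ip r r - (ip r v)\<^sup>2 - (ip r w)\<^sup>2)" if "finsupp r" for r
      using b that by (rule eigenvector_pair_bound[OF vw cd])
    ultimately have "ip (mat_vec_inf A r1) r1 + ip (mat_vec_inf A r2) r2 \<le>
        (c * (ip r1 v)\<^sup>2 + d * (ip r1 w)\<^sup>2 + s * (1 - (ip r1 v)\<^sup>2 - (ip r1 w)\<^sup>2)) +
        (c * (ip r2 v)\<^sup>2 + d * (ip r2 w)\<^sup>2 + s * (1 - (ip r2 v)\<^sup>2 - (ip r2 w)\<^sup>2))"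
      by (intro add_mono) metis+
    also have "\<dots> = c * \<alpha> r1 r2 + d * \<beta> r1 r2 + s * (2 - \<alpha> r1 r2 - \<beta> r1 r2)"
      unfolding \<alpha>_def \<beta>_def by algebra
    finally show ?thesis .
  qed
  \<comment> \<open>The principle of Ky Fan for two vectors: bounding the complement by the smaller
    of c and d leaves an expression that is largest when the other eigenvector lies in the
    plane.\<close>
  have "ip (mat_vec_inf A p1) p1 + ip (mat_vec_inf A p2) p2 \<le> c + d"
  proof (cases "c \<le> d")
    case True
    have "ip (mat_vec_inf A p1) p1 + ip (mat_vec_inf A p2) p2 \<le>
        c * \<alpha> p1 p2 + d * \<beta> p1 p2 + c * (2 - \<alpha> p1 p2 - \<beta> p1 p2)"
      using p(1) bound(1) by (rule pair)
    also have "\<dots> = 2 * c + (d - c) * \<beta> p1 p2"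
      by (simp add: algebra_simps)
    also have "\<dots> \<le> 2 * c + (d - c) * 1"
      using True le[OF p(1)] by (intro add_left_mono mult_left_mono) auto
    finally show ?thesis by simp
  next
    case False
    have "ip (mat_vec_inf A p1) p1 + ip (mat_vec_inf A p2) p2 \<le>
        c * \<alpha> p1 p2 + d * \<beta> p1 p2 + d * (2 - \<alpha> p1 p2 - \<beta> p1 p2)"
      using p(1) bound(2) by (rule pair)
    also have "\<dots> = 2 * d + (c - d) * \<alpha> p1 p2"
      by (simp add: algebra_simps)
    also have "\<dots> \<le> 2 * d + (c - d) * 1"
      using False le[OF p(1)] by (intro add_left_mono mult_left_mono) auto
    finally show ?thesis by simp
  qed
  then have cd2: "c + d \<ge> 2 - \<delta>" using p(2) by linarith
  moreover have "c \<le> 1" "d \<le> 1" using le1[OF o(1)] le1[OF o(2)] c d o by auto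
  ultimately have cd1: "1 - \<delta> \<le> c" "1 - \<delta> \<le> d" by linarith+
  \<comment> \<open>The parts of v and w missed by the plane of q. Both are nonnegative, so c and d
    may be lowered to 1 - \<delta> and 2 - c - d raised to \<delta>.\<close>
  let ?a = "1 - \<alpha> q1 q2" and ?b = "1 - \<beta> q1 q2"
  have "(1 - 2 * \<delta>) * (?a + ?b) = (1 - \<delta>) * ?a + (1 - \<delta>) * ?b - \<delta> * (?a + ?b)"
    by (simp add: algebra_simps)
  also have "\<dots> \<le> c * ?a + d * ?b - (2 - c - d) * (?a + ?b)"
    using cd1 cd2 le[OF q] by (intro diff_mono add_mono mult_right_mono) auto
  also have "\<dots> \<le> c + d - ip (mat_vec_inf A q1) q1 - ip (mat_vec_inf A q2) q2"
  proof -
    have "ip (mat_vec_inf A q1) q1 + ip (mat_vec_inf A q2) q2 \<le>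
        c * \<alpha> q1 q2 + d * \<beta> q1 q2 + (2 - c - d) * (2 - \<alpha> q1 q2 - \<beta> q1 q2)"
      using q bound(3) by (rule pair)
    then show ?thesis by (simp add: algebra_simps)
  qed
  finally show ?thesis by (simp add: c d \<alpha>_def \<beta>_def algebra_simps)
qed

end

subsection \<open>Frames\<close>

lemma gram_inf_eq_sum:
  assumes "finite K" "\<And>i. i \<notin> K \<Longrightarrow> X i = 0 \<or> Y i = 0"
  shows "gram_inf X Y = (\<Sum>i\<in>K. transpose (X i) ** Y i)"
proof -
  have "transpose (X i) ** Y i = 0" if "i \<notin> K" for i
    using assms(2)[OF that] by (auto simp: matrix2_simps)
  then show ?thesis
    unfolding gram_inf_def using assms(1) by (intro Sum_any.expand_superset) auto
qed

lemma V2_iff: "M \<in> V2 \<longleftrightarrow> finsupp M \<and> gram_inf M M = mat 1"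
  by (simp add: V2_def finsupp_def)

lemma transpose_sum: "transpose (\<Sum>i\<in>K. f i) = (\<Sum>i\<in>K. transpose (f i))"
  by (simp add: transpose_def vec_eq_iff)

lemma matrix_mult_sum_left: "(\<Sum>i\<in>K. f i) ** G = (\<Sum>i\<in>K. f i ** G)" for G :: "real^2^2"
  by (induction K rule: infinite_finite_induct)
     (auto simp: vec_eq_iff matrix_matrix_mult_def algebra_simps sum.distrib)

lemma matrix_mult_sum_right: "G ** (\<Sum>i\<in>K. f i) = (\<Sum>i\<in>K. G ** f i)" for G :: "real^2^2"
  by (induction K rule: infinite_finite_induct)
     (auto simp: vec_eq_iff matrix_matrix_mult_def algebra_simps sum.distrib)

lemma gram_inf_transpose:
  assumes "finsupp X"
  shows "transpose (gram_inf X Y) = gram_inf Y X"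
  using assms gram_inf_eq_sum[of "{i. X i \<noteq> 0}" X Y] gram_inf_eq_sum[of "{i. X i \<noteq> 0}" Y X]
  by (simp add: finsupp_def transpose_sum matrix_transpose_mul)

lemma gram_inf_mult_right:
  assumes "finsupp X"
  shows "gram_inf X (\<lambda>i. Y i ** G) = gram_inf X Y ** G"
  using assms gram_inf_eq_sum[of "{i. X i \<noteq> 0}" X]
  by (simp add: finsupp_def matrix_mult_sum_left matrix_mul_assoc)

lemma gram_inf_mult_left:
  assumes "finsupp Y"
  shows "gram_inf (\<lambda>i. X i ** G) Y = transpose G ** gram_inf X Y"
  using assms gram_inf_eq_sum[of "{i. Y i \<noteq> 0}" _ Y]
  by (simp add: finsupp_def matrix_mult_sum_right matrix_transpose_mul matrix_mul_assoc)

lemma matrix_diff_ldistrib2: "A ** (B - C) = A ** B - A ** C" for A B C :: "real^2^2"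
  by (simp add: matrix2_simps algebra_simps)

lemma gram_inf_diff_right:
  assumes "finsupp X"
  shows "gram_inf X (\<lambda>i. Y i - Z i) = gram_inf X Y - gram_inf X Z"
  using assms gram_inf_eq_sum[of "{i. X i \<noteq> 0}" X]
  by (simp add: finsupp_def matrix_diff_ldistrib2 sum_subtractf)

lemma finsupp_mult [simp]: "finsupp X \<Longrightarrow> finsupp (\<lambda>i. X i ** G)" for G :: "real^2^2"
  by (rule finsupp_map) (auto simp: matrix2_simps)

lemma ip_frame_mult:
  assumes "finsupp Y"
  shows "ip (\<lambda>i. X i ** G) Y = G \<bullet> gram_inf X Y"
  using assms gram_inf_eq_sum[of "{i. Y i \<noteq> 0}" X Y] ip_eq_sum[of "{i. Y i \<noteq> 0}" _ Y]
  by (simp add: finsupp_def inner_matrix_mult_left inner_sum_right)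

text \<open>Pythagoras: among the frames V G the one nearest to X has G = V^T X, and any other G
  adds its squared distance from that matrix.\<close>

lemma ip_diff_frame_mult:
  assumes X: "finsupp X" and V: "V \<in> V2"
  shows "ip (\<lambda>i. X i - V i ** G) (\<lambda>i. X i - V i ** G) =
    ip X X - (norm (gram_inf V X))\<^sup>2 + (norm (G - gram_inf V X))\<^sup>2"
proof -
  have V': "finsupp V" "gram_inf V V = mat 1" using V by (auto simp: V2_iff)
  have "ip (\<lambda>i. V i ** G) X = G \<bullet> gram_inf V X" by (rule ip_frame_mult[OF X])
  moreover have "ip (\<lambda>i. V i ** G) (\<lambda>i. V i ** G) = G \<bullet> G"
    using V' by (simp add: ip_frame_mult gram_inf_mult_right)
  ultimately show ?thesis
    using X V' ip_commute[of X "\<lambda>i. V i ** G"]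
    by (simp add: power2_norm_eq_inner inner_diff_left inner_diff_right inner_commute)
qed

lemma norm_gram_inf_le:
  assumes "finsupp X" "V \<in> V2"
  shows "(norm (gram_inf V X))\<^sup>2 \<le> ip X X"
  using ip_diff_frame_mult[OF assms, of "gram_inf V X"]
    ip_ge_0[of "\<lambda>i. X i - V i ** gram_inf V X"] by simp

lemma ip_V2: "V \<in> V2 \<Longrightarrow> ip V V = 2"
  using ip_frame_mult[of V V "mat 1"] norm_mat_1_2 by (simp add: V2_iff power2_norm_eq_inner)

lemma norm_one_minus_gram_square_le:
  assumes "X \<in> V2" "V \<in> V2"
  shows "norm (transpose (gram_inf V X) ** gram_inf V X - mat 1) \<le> 2 * (2 - (norm (gram_inf V X))\<^sup>2)"
proof -
  define G where "G = gram_inf V X"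
  have V: "finsupp V" "gram_inf V V = mat 1" and X: "finsupp X" "gram_inf X X = mat 1"
    using assms by (auto simp: V2_iff)
  text \<open>\<open>E\<close> is the Gram matrix of the component of \<open>X\<close> orthogonal to \<open>V\<close>; positive
    semidefinite matrices are bounded by their trace.\<close>
  define E where "E = mat 1 - transpose G ** G"
  have form: "0 \<le> x \<bullet> (E *v x)" for x
  proof -
    \<comment> \<open>The frame inequality is turned into one for vectors by a frame with first
      column X x and second column zero.\<close>
    let ?M = "vector [vector [x$1, 0], vector [x$2, 0]] :: real^2^2"
    have "(norm (gram_inf V (\<lambda>i. X i ** ?M)))\<^sup>2 \<le> ip (\<lambda>i. X i ** ?M) (\<lambda>i. X i ** ?M)"
      using X assms by (intro norm_gram_inf_le) auto
    then have "(G ** ?M) \<bullet> (G ** ?M) \<le> ?M \<bullet> ?M"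
      using X V by (simp add: gram_inf_mult_right ip_frame_mult power2_norm_eq_inner G_def)
    then show ?thesis
      by (simp add: E_def matrix2_simps algebra_simps)
  qed
  have sym: "E$2$1 = E$1$2" by (simp add: E_def matrix2_simps)
  have d: "0 \<le> E$1$1" "0 \<le> E$2$2"
    using form[of "axis 1 1"] form[of "axis 2 1"] by (simp_all add: matrix2_simps axis_def)
  \<comment> \<open>Nonnegativity at (1, 1) and (1, -1) bounds the off-diagonal entry by the
    trace.\<close>
  have o: "\<bar>2 * E$1$2\<bar> \<le> E$1$1 + E$2$2"
    using form[of "vector [1, 1]"] form[of "vector [1, -1]"] sym
    by (simp add: matrix2_simps abs_le_iff)
  have tr: "E$1$1 + E$2$2 = 2 - (norm G)\<^sup>2"
    by (simp add: E_def matrix2_simps power2_norm_eq_inner)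
  define t where "t = E$1$1 + E$2$2"
  have "(norm E)\<^sup>2 = (E$1$1)\<^sup>2 + (E$2$2)\<^sup>2 + (2 * E$1$2)\<^sup>2 / 2"
    unfolding power2_norm_eq_inner by (simp add: inner_vec_def sum_2 sym power2_eq_square)
  also have "\<dots> \<le> t\<^sup>2 + t\<^sup>2 + t\<^sup>2 / 2"
  proof -
    have "(E$1$1)\<^sup>2 \<le> t\<^sup>2" "(E$2$2)\<^sup>2 \<le> t\<^sup>2" "\<bar>2 * E$1$2\<bar>\<^sup>2 \<le> t\<^sup>2"
      using d o unfolding t_def by (intro power_mono; simp)+
    then show ?thesis by simp
  qed
  also have "\<dots> \<le> (2 * t)\<^sup>2" by (simp add: power2_eq_square)
  finally have "norm E \<le> 2 * t"
    by (rule power2_le_imp_le) (use d in \<open>simp add: t_def\<close>)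
  then have "norm E \<le> 2 * (2 - (norm G)\<^sup>2)" by (simp add: t_def tr)
  then show ?thesis by (simp add: E_def G_def norm_minus_commute)
qed

section \<open>Columns of frames and the energy\<close>

definition col :: "inf_frame \<Rightarrow> 2 \<Rightarrow> inf_vec" where
  "col M a = (\<lambda>i. column a (M i))"

definition frame_of :: "inf_vec \<Rightarrow> inf_vec \<Rightarrow> inf_frame" where
  "frame_of v w = (\<lambda>i. \<chi> r a. if a = 1 then v i $ r else w i $ r)"

lemma col_frame_of [simp]: "col (frame_of v w) 1 = v" "col (frame_of v w) 2 = w"
  by (auto simp: col_def frame_of_def column_def vec_eq_iff fun_eq_iff)

lemma finsupp_col [simp]: "finsupp M \<Longrightarrow> finsupp (col M a)"
  unfolding col_def by (rule finsupp_map) (auto simp: column_def vec_eq_iff)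

lemma finsupp_frame_of [simp]:
  assumes "finsupp v" "finsupp w" shows "finsupp (frame_of v w)"
  using assms by (rule finsupp_superset) (erule finsuppI, auto simp: frame_of_def vec_eq_iff)

lemma transpose_mult_nth: "(transpose A ** B) $ a $ b = column a A \<bullet> column b B"
  for A B :: "real^2^2"
  by (simp add: matrix_matrix_mult_def transpose_def column_def inner_vec_def)

lemma gram_inf_nth:
  assumes "finsupp X"
  shows "gram_inf X Y $ a $ b = ip (col X a) (col Y b)"
proof -
  let ?K = "{i. X i \<noteq> 0}"
  have "ip (col X a) (col Y b) = (\<Sum>i\<in>?K. col X a i \<bullet> col Y b i)"
    using assms by (intro ip_eq_sum) (auto simp: finsupp_def col_def column_def vec_eq_iff)
  moreover have "gram_inf X Y = (\<Sum>i\<in>?K. transpose (X i) ** Y i)"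
    using assms by (intro gram_inf_eq_sum) (auto simp: finsupp_def)
  ultimately show ?thesis
    by (simp add: col_def transpose_mult_nth)
qed

lemma norm_gram_inf:
  assumes "finsupp X"
  shows "(norm (gram_inf X Y))\<^sup>2 = (ip (col X 1) (col Y 1))\<^sup>2 + (ip (col X 2) (col Y 1))\<^sup>2 +
    ((ip (col X 1) (col Y 2))\<^sup>2 + (ip (col X 2) (col Y 2))\<^sup>2)"
  unfolding power2_norm_eq_inner inner_vec_def sum_2 gram_inf_nth[OF assms]
  by (simp add: power2_eq_square)

lemma orthonormal2_col_iff:
  assumes "finsupp M"
  shows "orthonormal2 (col M 1) (col M 2) \<longleftrightarrow> M \<in> V2"
  using assms gram_inf_nth[OF assms, of M] ip_commute[of "col M 2" "col M 1"]
  by (auto simp: orthonormal2_def V2_iff vec_eq_iff forall_2 mat_def)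

lemma frame_of_V2: "orthonormal2 v w \<Longrightarrow> frame_of v w \<in> V2"
  using orthonormal2_col_iff[of "frame_of v w"] by (auto simp: orthonormal2_def)

lemma frame_of_mult:
  "(frame_of v w i ** G) = (\<chi> r a. G$1$a * v i $ r + G$2$a * w i $ r)"
  by (auto simp: matrix2_simps frame_of_def)

text \<open>The trace of Q^T A Q.\<close>

definition energy :: "inf_mat \<Rightarrow> inf_frame \<Rightarrow> real" where
  "energy A Q = ip (mat_vec_inf A (col Q 1)) (col Q 1) + ip (mat_vec_inf A (col Q 2)) (col Q 2)"

text \<open>The pairing of A with Q Q^T: the energy sees Q only through its projection and is linear
  in A, which makes energies at two different points comparable.\<close>

lemma energy_eq_sum:
  assumes "finite K" "symmetric_on K A"
  shows "energy A Q = (\<Sum>i\<in>K. \<Sum>k\<in>K. A i k \<bullet> (Q i ** transpose (Q k)))"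
  unfolding energy_def ip_mat_vec_inf_eq_sum[OF assms] sum.distrib[symmetric]
  by (intro sum.cong refl) (simp add: col_def matrix2_simps algebra_simps)

subsection \<open>Weighted averages of projections\<close>

text \<open>The situation at a single point: r holds the values of the partition of unity.
  Orthonormality is asked only for nonzero weights, since the frame with index j is guaranteed to be
  orthonormal only on \<open>U j\<close>.\<close>

locale frame_average =
  fixes J :: "nat set" and r :: "nat \<Rightarrow> real" and P :: "nat \<Rightarrow> inf_frame"
  assumes finite_J: "finite J"
    and weight_nonneg: "\<And>j. j \<in> J \<Longrightarrow> 0 \<le> r j"
    and weight_sum: "(\<Sum>j\<in>J. r j) = 1"
    and P_outside: "\<And>j i. j \<in> J \<Longrightarrow> i \<notin> J \<Longrightarrow> P j i = 0"
    and P_V2: "\<And>j. j \<in> J \<Longrightarrow> r j \<noteq> 0 \<Longrightarrow> P j \<in> V2"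
begin

definition average :: inf_mat where
  "average = (\<lambda>i k. \<Sum>j\<in>J. r j *\<^sub>R (P j i ** transpose (P j k)))"

lemma P_finsupp: "j \<in> J \<Longrightarrow> finsupp (P j)"
  using finite_J P_outside by (rule finsuppI)

lemma symmetric_average: "symmetric_on J average"
  unfolding symmetric_on_def average_def
proof (intro conjI allI impI)
  show "(\<Sum>j\<in>J. r j *\<^sub>R (P j k ** transpose (P j i))) =
      transpose (\<Sum>j\<in>J. r j *\<^sub>R (P j i ** transpose (P j k)))" for i k
    by (simp add: transpose_sum transpose_scalar matrix_transpose_mul)
  show "(\<Sum>j\<in>J. r j *\<^sub>R (P j i ** transpose (P j k))) = 0" if "i \<notin> J" for i k
    using that P_outside by (intro sum.neutral) (auto simp: matrix2_simps)
qed

lemma ip_average: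
  "ip (mat_vec_inf average x) y = (\<Sum>j\<in>J. r j *
    (ip (col (P j) 1) x * ip (col (P j) 1) y + ip (col (P j) 2) x * ip (col (P j) 2) y))"
proof -
  have c: "ip (col (P j) a) z = (\<Sum>i\<in>J. column a (P j i) \<bullet> z i)" if "j \<in> J" for j a z
    unfolding col_def using finite_J P_outside[OF that]
    by (intro ip_eq_sum) (auto simp: column_def vec_eq_iff)
  have "ip (mat_vec_inf average x) y = (\<Sum>i\<in>J. \<Sum>k\<in>J. (average i k *v x k) \<bullet> y i)"
    by (rule ip_mat_vec_inf_eq_sum[OF finite_J symmetric_average])
  also have "\<dots> = (\<Sum>i\<in>J. \<Sum>k\<in>J. \<Sum>j\<in>J. r j *
      (column 1 (P j k) \<bullet> x k * (column 1 (P j i) \<bullet> y i) +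
       column 2 (P j k) \<bullet> x k * (column 2 (P j i) \<bullet> y i)))"
  proof (intro sum.cong refl)
    fix i k
    have "(average i k *v x k) \<bullet> y i = (\<Sum>j\<in>J. r j * (((P j i ** transpose (P j k)) *v x k) \<bullet> y i))"
      unfolding average_def
      by (induction J rule: infinite_finite_induct)
         (auto simp: algebra_simps inner_add_left scaleR_matrix_vector_assoc[symmetric])
    also have "\<dots> = (\<Sum>j\<in>J. r j *
      (column 1 (P j k) \<bullet> x k * (column 1 (P j i) \<bullet> y i) +
       column 2 (P j k) \<bullet> x k * (column 2 (P j i) \<bullet> y i)))"
      by (intro sum.cong refl) (simp add: matrix2_simps algebra_simps)
    finally show "(average i k *v x k) \<bullet> y i = \<dots>" .
  qed
  also have "\<dots> = (\<Sum>j\<in>J. \<Sum>i\<in>J. \<Sum>k\<in>J. r j *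
      (column 1 (P j k) \<bullet> x k * (column 1 (P j i) \<bullet> y i) +
       column 2 (P j k) \<bullet> x k * (column 2 (P j i) \<bullet> y i)))"
    by (rule trans[OF sum.cong[OF refl sum.swap] sum.swap])
  also have "\<dots> = (\<Sum>j\<in>J. r j *
    (ip (col (P j) 1) x * ip (col (P j) 1) y + ip (col (P j) 2) x * ip (col (P j) 2) y))"
  proof (intro sum.cong refl)
    fix j assume j: "j \<in> J"
    have "ip (col (P j) a) x * ip (col (P j) a) y =
        (\<Sum>i\<in>J. \<Sum>k\<in>J. column a (P j k) \<bullet> x k * (column a (P j i) \<bullet> y i))" for a
      unfolding c[OF j] by (subst mult.commute, unfold sum_product) (intro sum.cong refl mult.commute)
    then show "(\<Sum>i\<in>J. \<Sum>k\<in>J. r j *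
      (column 1 (P j k) \<bullet> x k * (column 1 (P j i) \<bullet> y i) +
       column 2 (P j k) \<bullet> x k * (column 2 (P j i) \<bullet> y i))) =
      r j * (ip (col (P j) 1) x * ip (col (P j) 1) y + ip (col (P j) 2) x * ip (col (P j) 2) y)"
      by (simp add: sum_distrib_left[symmetric] sum.distrib)
  qed
  finally show ?thesis .
qed

lemma energy_average:
  "energy average Q = (\<Sum>j\<in>J. r j * (norm (gram_inf (P j) Q))\<^sup>2)"
proof -
  have "r j * (norm (gram_inf (P j) Q))\<^sup>2 =
      r j * (ip (col (P j) 1) (col Q 1) * ip (col (P j) 1) (col Q 1) +
             ip (col (P j) 2) (col Q 1) * ip (col (P j) 2) (col Q 1)) +
      r j * (ip (col (P j) 1) (col Q 2) * ip (col (P j) 1) (col Q 2) +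
             ip (col (P j) 2) (col Q 2) * ip (col (P j) 2) (col Q 2))" if "j \<in> J" for j
    by (simp only: norm_gram_inf[OF P_finsupp[OF that]]) (simp only: power2_eq_square distrib_left)
  then show ?thesis
    by (simp add: energy_def ip_average sum.distrib[symmetric])
qed

lemma average_psd: "0 \<le> ip (mat_vec_inf average x) x"
  unfolding ip_average by (intro sum_nonneg mult_nonneg_nonneg weight_nonneg) auto

text \<open>Terms of weight zero vanish, so it is enough to bound the others, whose frames are
  orthonormal.\<close>

lemma average_weight_mono:
  assumes "\<And>j. j \<in> J \<Longrightarrow> P j \<in> V2 \<Longrightarrow> f j \<le> c"
  shows "(\<Sum>j\<in>J. r j * f j) \<le> c"
proof -
  have "(\<Sum>j\<in>J. r j * f j) \<le> (\<Sum>j\<in>J. r j * c)"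
  proof (rule sum_mono)
    fix j assume j: "j \<in> J"
    show "r j * f j \<le> r j * c"
      using weight_nonneg[OF j] assms[OF j] P_V2[OF j] by (cases "r j = 0") (auto intro: mult_left_mono)
  qed
  also have "\<dots> = c" by (simp add: sum_distrib_right[symmetric] weight_sum)
  finally show ?thesis .
qed

lemma average_le_one: "finsupp x \<Longrightarrow> ip (mat_vec_inf average x) x \<le> ip x x"
  unfolding ip_average
proof (rule average_weight_mono)
  fix j assume x: "finsupp x" and j: "j \<in> J" "P j \<in> V2"
  then have "orthonormal2 (col (P j) 1) (col (P j) 2)" by (simp add: orthonormal2_col_iff P_finsupp)
  from bessel2[OF this x]
  show "ip (col (P j) 1) x * ip (col (P j) 1) x + ip (col (P j) 2) x * ip (col (P j) 2) x \<le> ip x x"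
    by (simp add: power2_eq_square ip_commute[of x "col (P j) _"])
qed

text \<open>Each projection contributes at most its rank 2: apply Bessel for x, y, z to the two
  columns of \<open>P j\<close>, then average.\<close>

lemma average_trace_le:
  assumes "orthonormal2 x y" "finsupp z" "ip z z = 1" "ip z x = 0" "ip z y = 0"
  shows "ip (mat_vec_inf average x) x + ip (mat_vec_inf average y) y +
    ip (mat_vec_inf average z) z \<le> 2"
  unfolding ip_average sum.distrib[symmetric] distrib_left[symmetric]
proof (rule average_weight_mono)
  fix j assume j: "j \<in> J" "P j \<in> V2"
  let ?u = "col (P j)"
  have u: "orthonormal2 (?u 1) (?u 2)" using j by (simp add: orthonormal2_col_iff P_finsupp)
  have "(ip (?u a) x)\<^sup>2 + (ip (?u a) y)\<^sup>2 + (ip (?u a) z)\<^sup>2 \<le> ip (?u a) (?u a)" for a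
    using j by (intro bessel3 assms) (simp add: P_finsupp)
  from this[of 1] this[of 2] show
   "ip (?u 1) x * ip (?u 1) x + ip (?u 2) x * ip (?u 2) x +
    (ip (?u 1) y * ip (?u 1) y + ip (?u 2) y * ip (?u 2) y) +
    (ip (?u 1) z * ip (?u 1) z + ip (?u 2) z * ip (?u 2) z) \<le> 2"
    using u by (simp add: orthonormal2_def power2_eq_square)
qed

text \<open>The spectral gap in the language of frames; N is the near maximiser whose existence
  forces the gap.\<close>

lemma energy_gap:
  assumes top: "top_eigenvectors average v w"
    and N: "N \<in> V2" "2 - \<delta> \<le> energy average N" and Q: "Q \<in> V2"
  shows "(1 - 2 * \<delta>) * (2 - (norm (gram_inf (frame_of v w) Q))\<^sup>2) \<le>
    energy average (frame_of v w) - energy average Q"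
proof -
  have o: "orthonormal2 (col N 1) (col N 2)" "orthonormal2 (col Q 1) (col Q 2)"
    using N Q by (simp_all add: orthonormal2_col_iff V2_iff)
  have vw: "finsupp (frame_of v w)"
    using top_eigenvectors_orthonormal2[OF top] by (simp add: orthonormal2_def)
  have "(1 - 2 * \<delta>) * (2 - ((ip (col Q 1) v)\<^sup>2 + (ip (col Q 1) w)\<^sup>2 +
      (ip (col Q 2) v)\<^sup>2 + (ip (col Q 2) w)\<^sup>2)) \<le>
    ip (mat_vec_inf average v) v + ip (mat_vec_inf average w) w
      - ip (mat_vec_inf average (col Q 1)) (col Q 1) - ip (mat_vec_inf average (col Q 2)) (col Q 2)"
    using N(2) unfolding energy_def
    by (intro spectral_gap[OF finite_J symmetric_average top _ _ o(1) _ o(2)]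
        average_le_one average_trace_le)
  then show ?thesis
    by (simp add: energy_def norm_gram_inf[OF vw] ip_commute[of v] ip_commute[of w] algebra_simps)
qed

end

subsection \<open>Projections and polar factors\<close>

text \<open>The image lies in the plane, and pairing the residual with v and w determines its two
  coefficients.\<close>

lemma mat_vec_orthogonal_projection:
  assumes vw: "orthonormal2 v w" and P: "orthogonal_projection_onto (span2_inf v w) P"
    and x: "finsupp x"
  shows "mat_vec_inf P x = (\<lambda>i. ip x v *\<^sub>R v i + ip x w *\<^sub>R w i)"
proof -
  have o: "finsupp v" "finsupp w" "ip v v = 1" "ip w w = 1" "ip v w = 0" "ip w v = 0"
    using vw ip_commute[of w v] by (auto simp: orthonormal2_def)
  have v: "v \<in> span2_inf v w"
    unfolding span2_inf_def by (rule CollectI, rule exI[of _ 1], rule exI[of _ 0]) simp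
  have w: "w \<in> span2_inf v w"
    unfolding span2_inf_def by (rule CollectI, rule exI[of _ 0], rule exI[of _ 1]) simp
  have Px: "mat_vec_inf P x \<in> span2_inf v w"
    "\<And>y. y \<in> span2_inf v w \<Longrightarrow> ip (\<lambda>i. x i - mat_vec_inf P x i) y = 0"
    using P x by (auto simp: orthogonal_projection_onto_def inner_inf_eq_ip)
  then obtain a c where ac: "mat_vec_inf P x = (\<lambda>i. a *\<^sub>R v i + c *\<^sub>R w i)"
    by (auto simp: span2_inf_def)
  have "ip x v = a" "ip x w = c"
    using Px(2)[OF v] Px(2)[OF w] o by (simp_all add: ac)
  then show ?thesis by (simp add: ac)
qed

lemma orthogonal_projection_exists:
  assumes vw: "orthonormal2 v w"
  shows "\<exists>P. orthogonal_projection_onto (span2_inf v w) P"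
proof -
  have o: "finsupp v" "finsupp w" "ip v v = 1" "ip w w = 1" "ip v w = 0" "ip w v = 0"
    using vw ip_commute[of w v] by (auto simp: orthonormal2_def)
  \<comment> \<open>This is v v^T + w w^T, written in blocks.\<close>
  define P :: inf_mat where "P = (\<lambda>i k. \<chi> r s. v i $ r * v k $ s + w i $ r * w k $ s)"
  have P: "mat_vec_inf P x = (\<lambda>i. ip x v *\<^sub>R v i + ip x w *\<^sub>R w i)" if x: "finsupp x" for x
  proof
    fix i
    define K where "K = {i. x i \<noteq> 0}"
    have K: "finite K" "\<And>i. i \<notin> K \<Longrightarrow> x i = 0"
      using x by (auto simp: K_def finsupp_def)
    have "mat_vec_inf P x i = (\<Sum>k\<in>K. P i k *v x k)"
    proof -
      have "P i k *v x k = 0" if "k \<notin> K" for k using K(2)[OF that] by simp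
      then show ?thesis
        unfolding mat_vec_inf_def using K(1) by (intro Sum_any.expand_superset) auto
    qed
    also have "\<dots> = (\<Sum>k\<in>K. (x k \<bullet> v k) *\<^sub>R v i + (x k \<bullet> w k) *\<^sub>R w i)"
      by (intro sum.cong refl) (simp add: P_def matrix2_simps algebra_simps)
    also have "\<dots> = ip x v *\<^sub>R v i + ip x w *\<^sub>R w i"
      using K by (simp add: ip_eq_sum[of K] sum.distrib scaleR_sum_left)
    finally show "mat_vec_inf P x i = ip x v *\<^sub>R v i + ip x w *\<^sub>R w i" .
  qed
  have "orthogonal_projection_onto (span2_inf v w) P"
    unfolding orthogonal_projection_onto_def inner_inf_eq_ip
    using o by (auto simp: P span2_inf_def)
  then show ?thesis by blast
qed

lemma column_mult: "column a (A ** B) = A *v column a B" for A B :: "real^2^2"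
  by (simp add: matrix2_simps)

lemma column_sum: "column a (\<Sum>k\<in>K. f k) = (\<Sum>k\<in>K. column a (f k))" for f :: "nat \<Rightarrow> real^2^2"
  by (simp add: column_def vec_eq_iff)

text \<open>Column by column, the projection acts as V V^T with V the frame of v and w.\<close>

lemma mat_frame_orthogonal_projection:
  assumes vw: "orthonormal2 v w" and P: "orthogonal_projection_onto (span2_inf v w) P"
    and M: "finsupp M"
  shows "mat_frame_inf P M = (\<lambda>i. frame_of v w i ** gram_inf (frame_of v w) M)"
proof -
  have f: "finsupp (frame_of v w)" using vw by (simp add: orthonormal2_def)
  have c: "column a (mat_frame_inf P M i) = mat_vec_inf P (col M a) i" for a i
  proof -
    let ?K = "{i. M i \<noteq> 0}"
    have "mat_frame_inf P M i = (\<Sum>k\<in>?K. P i k ** M k)"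
    proof -
      have "P i k ** M k = 0" if "M k = 0" for k
        using that by (simp add: matrix2_simps)
      then show ?thesis
        unfolding mat_frame_inf_def using M
        by (intro Sum_any.expand_superset) (auto simp: finsupp_def)
    qed
    moreover have "mat_vec_inf P (col M a) i = (\<Sum>k\<in>?K. P i k *v col M a k)"
    proof -
      have "P i k *v col M a k = 0" if "M k = 0" for k
        using that by (simp add: col_def column_def zero_vec_def[symmetric])
      then show ?thesis
        unfolding mat_vec_inf_def using M
        by (intro Sum_any.expand_superset) (auto simp: finsupp_def)
    qed
    ultimately show ?thesis
      by (simp add: col_def column_mult column_sum)
  qed
  have "column a (mat_frame_inf P M i) = column a (frame_of v w i ** gram_inf (frame_of v w) M)" for a i
    unfolding c mat_vec_orthogonal_projection[OF vw P finsupp_col[OF M]] frame_of_mult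
    by (simp add: gram_inf_nth[OF f] ip_commute[of v] ip_commute[of w] column_def vec_eq_iff)
  then show ?thesis by (simp add: fun_eq_iff vec_eq_iff column_def)
qed

text \<open>As V has orthonormal columns, the polar factor of V G is V times that of G. Any
  decomposition V G = Q H' has H'^2 = G^T G, so the inverse of H' is the fixed inverse root and Q is
  determined. The last bound comes from R - G = R (1 - H).\<close>

lemma polar_factor_mult:
  assumes V: "V \<in> V2" and G: "det G \<noteq> 0"
  defines "R \<equiv> G ** inv_sqrt2 (transpose G ** G)"
  shows "polar_factor (\<lambda>i. V i ** G) = (\<lambda>i. V i ** R)"
    and "orthogonal_matrix R"
    and "norm (R - G) \<le> norm (transpose G ** G - mat 1)"
proof -
  define S where "S = transpose G ** G"
  have dS: "det S > 0" using G by (auto simp: S_def det_mul zero_less_mult_iff)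
  have V': "finsupp V" "gram_inf V V = mat 1" using V by (auto simp: V2_iff)
  obtain H where H: "psd2 H" "H ** H = S"
    using psd2_square_root_exists[OF G] by (auto simp: S_def)
  note inv = inv_sqrt2_inverse[OF H dS]
  have RH: "R ** H = G"
    using inv by (simp add: R_def S_def[symmetric] matrix_mul_assoc[symmetric])
  have symH: "transpose H = H" using H by (simp add: psd2_def)
  have "transpose R ** R = mat 1"
  proof -
    have "transpose (inv_sqrt2 S) ** H = mat 1"
      using arg_cong[OF inv(1), of transpose] symH by (simp add: matrix_transpose_mul)
    \<comment> \<open>A left inverse and a right inverse of H coincide.\<close>
    then have "transpose (inv_sqrt2 S) = inv_sqrt2 S"
      using inv(1) by (metis matrix_mul_assoc matrix_mul_lid matrix_mul_rid)
    then have "transpose R ** R = inv_sqrt2 S ** S ** inv_sqrt2 S"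
      by (simp add: R_def S_def[symmetric] matrix_transpose_mul)
         (simp add: S_def matrix_mul_assoc)
    also have "\<dots> = (inv_sqrt2 S ** H) ** (H ** inv_sqrt2 S)"
      by (simp add: H(2)[symmetric] matrix_mul_assoc)
    finally show ?thesis using inv by simp
  qed
  then show orth: "orthogonal_matrix R" by (simp add: orthogonal_matrix)
  have unique: "Q = (\<lambda>i. V i ** R)"
    if Q: "Q \<in> V2" and H': "transpose H' = H'" "\<forall>x. 0 \<le> x \<bullet> (H' *v x)" and
      eq: "(\<lambda>i. V i ** G) = (\<lambda>i. Q i ** H')" for Q H'
  proof -
    have Q': "finsupp Q" "gram_inf Q Q = mat 1" using Q by (auto simp: V2_iff)
    have "gram_inf (\<lambda>i. V i ** G) (\<lambda>i. V i ** G) = S"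
      using V' by (simp add: gram_inf_mult_left gram_inf_mult_right S_def)
    moreover have "gram_inf (\<lambda>i. V i ** G) (\<lambda>i. V i ** G) = H' ** H'"
      unfolding eq using Q' H' by (simp add: gram_inf_mult_left gram_inf_mult_right)
    ultimately have "H' ** H' = S" by simp
    moreover have "psd2 H'" using H' by (simp add: psd2_def)
    ultimately have "H' ** inv_sqrt2 S = mat 1" using dS by (intro inv_sqrt2_inverse) auto
    then show ?thesis
      using fun_cong[OF eq] by (metis R_def S_def matrix_mul_assoc matrix_mul_rid)
  qed
  have "(\<lambda>i. V i ** R) \<in> V2"
    using V' orth by (simp add: V2_iff gram_inf_mult_left gram_inf_mult_right orthogonal_matrix)
  moreover have "(\<lambda>i. V i ** G) = (\<lambda>i. (V i ** R) ** H)"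
    by (simp add: matrix_mul_assoc[symmetric] RH)
  ultimately have ex: "(\<lambda>i. V i ** R) \<in> V2 \<and> (\<exists>H :: real^2^2. transpose H = H \<and>
      (\<forall>x. 0 \<le> x \<bullet> (H *v x)) \<and> (\<lambda>i. V i ** G) = (\<lambda>i. (V i ** R) ** H))"
    using H(1) unfolding psd2_def by blast
  show "polar_factor (\<lambda>i. V i ** G) = (\<lambda>i. V i ** R)"
    unfolding polar_factor_def
  proof (rule some_equality)
    show "(\<lambda>i. V i ** R) \<in> V2 \<and> (\<exists>H :: real^2^2. transpose H = H \<and>
      (\<forall>x. 0 \<le> x \<bullet> (H *v x)) \<and> (\<lambda>i. V i ** G) = (\<lambda>i. (V i ** R) ** H))" by (rule ex)
  qed (use unique in blast)
  have "norm (R - G) = norm (R ** (H - mat 1))"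
    by (simp add: matrix_diff_ldistrib2 RH norm_minus_commute)
  also have "\<dots> = norm (H - mat 1)" by (rule norm_orthogonal_mult(1)[OF orth])
  also have "\<dots> \<le> norm (H ** H - mat 1)" by (rule norm_psd2_diff_one[OF H(1)])
  finally show "norm (R - G) \<le> norm (transpose G ** G - mat 1)" by (simp add: H(2) S_def)
qed

section \<open>Frobenius distance of projections\<close>

lemma projection_block_inner_sum:
  assumes "finsupp X" "finsupp Y" "finite K" "{i. X i \<noteq> 0} \<subseteq> K"
  shows "(\<Sum>i\<in>K. \<Sum>l\<in>K. (X i ** transpose (X l)) \<bullet> (Y i ** transpose (Y l))) =
    (norm (gram_inf X Y))\<^sup>2"
proof -
  have "gram_inf X Y = (\<Sum>i\<in>K. transpose (X i) ** Y i)"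
    using assms by (intro gram_inf_eq_sum) auto
  then show ?thesis
    by (simp add: inner_mult_transpose power2_norm_eq_inner inner_sum_left inner_sum_right)
       (rule sum.swap)
qed

text \<open>A single block is bounded by the whole difference, and the squared Frobenius norm of X
  X^T - Y Y^T is 2 + 2 minus twice the trace of X X^T Y Y^T.\<close>

lemma projection_block_distance:
  assumes X: "X \<in> V2" and Y: "Y \<in> V2"
  shows "(norm (X i ** transpose (X l) - Y i ** transpose (Y l)))\<^sup>2 \<le>
    4 - 2 * (norm (gram_inf X Y))\<^sup>2"
proof -
  have f: "finsupp X" "finsupp Y" and g: "gram_inf X X = mat 1" "gram_inf Y Y = mat 1"
    using X Y by (auto simp: V2_iff)
  \<comment> \<open>The positions i and l are inserted so that the block in question is among the
    summands.\<close>
  define K where "K = insert i (insert l ({i. X i \<noteq> 0} \<union> {i. Y i \<noteq> 0}))"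
  have K: "finite K" using f by (simp add: K_def finsupp_def)
  have sub: "{i. X i \<noteq> 0} \<subseteq> K" "{i. Y i \<noteq> 0} \<subseteq> K" by (auto simp: K_def)
  define D where "D i l = X i ** transpose (X l) - Y i ** transpose (Y l)" for i l
  have "(norm (D i l))\<^sup>2 \<le> (\<Sum>l\<in>K. (norm (D i l))\<^sup>2)"
    using K by (intro member_le_sum) (auto simp: K_def)
  also have "\<dots> \<le> (\<Sum>i\<in>K. \<Sum>l\<in>K. (norm (D i l))\<^sup>2)"
    using K by (intro member_le_sum[of i K "\<lambda>i. \<Sum>l\<in>K. (norm (D i l))\<^sup>2"] sum_nonneg) (auto simp: K_def)
  also have "\<dots> = (\<Sum>i\<in>K. \<Sum>l\<in>K. (X i ** transpose (X l)) \<bullet> (X i ** transpose (X l)))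
      - 2 * (\<Sum>i\<in>K. \<Sum>l\<in>K. (X i ** transpose (X l)) \<bullet> (Y i ** transpose (Y l)))
      + (\<Sum>i\<in>K. \<Sum>l\<in>K. (Y i ** transpose (Y l)) \<bullet> (Y i ** transpose (Y l)))"
    unfolding sum_distrib_left sum_subtractf[symmetric] sum.distrib[symmetric]
    by (intro sum.cong refl)
       (simp add: D_def power2_norm_eq_inner inner_diff_left inner_diff_right inner_commute)
  also have "\<dots> = 4 - 2 * (norm (gram_inf X Y))\<^sup>2"
    unfolding projection_block_inner_sum[OF f(1) f(1) K sub(1)]
      projection_block_inner_sum[OF f K sub(1)] projection_block_inner_sum[OF f(2) f(2) K sub(2)]
    by (simp add: g norm_mat_1_2)
  finally show ?thesis by (simp add: D_def)
qed

lemma projection_block_bound: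
  assumes X: "X \<in> V2"
  shows "norm (X i ** transpose (X l)) \<le> 2"
proof -
  have f: "finsupp X" and g: "gram_inf X X = mat 1" using X by (auto simp: V2_iff)
  define K where "K = insert i (insert l {i. X i \<noteq> 0})"
  have K: "finite K" using f by (simp add: K_def finsupp_def)
  let ?f = "\<lambda>i l. (X i ** transpose (X l)) \<bullet> (X i ** transpose (X l))"
  have "?f i l \<le> (\<Sum>l\<in>K. ?f i l)"
    using K by (intro member_le_sum) (auto simp: K_def)
  also have "\<dots> \<le> (\<Sum>i\<in>K. \<Sum>l\<in>K. ?f i l)"
    using K by (intro member_le_sum[of i K "\<lambda>i. \<Sum>l\<in>K. ?f i l"] sum_nonneg) (auto simp: K_def)
  also have "\<dots> = (norm (gram_inf X X))\<^sup>2"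
    using K by (intro projection_block_inner_sum[OF f f]) (auto simp: K_def)
  also have "\<dots> \<le> 2\<^sup>2" by (simp add: g norm_mat_1_2)
  finally have "(norm (X i ** transpose (X l)))\<^sup>2 \<le> 2\<^sup>2" by (simp add: power2_norm_eq_inner)
  then show ?thesis by (rule power2_le_imp_le) simp
qed

text \<open>\<open>Pi_Gr\<close> is specified by choice. A classifying frame consists of top
  eigenvectors for which the projection actually chosen acts as V V^T.\<close>

definition classifying_frame :: "inf_mat \<Rightarrow> inf_frame \<Rightarrow> bool" where
  "classifying_frame A V \<longleftrightarrow> (\<exists>v w. top_eigenvectors A v w \<and> V = frame_of v w \<and>
     (\<forall>M. finsupp M \<longrightarrow> mat_frame_inf (Pi_Gr A) M = (\<lambda>i. V i ** gram_inf V M)))"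

lemma classifying_frame_V2: "classifying_frame A V \<Longrightarrow> V \<in> V2"
  unfolding classifying_frame_def using frame_of_V2 top_eigenvectors_orthonormal2 by blast

lemma sym_part_symmetric:
  assumes "symmetric_on K A"
  shows "sym_part A = A"
proof -
  have "transpose (A k i) = A i k" for i k using assms unfolding symmetric_on_def by metis
  then show ?thesis by (simp add: sym_part_def fun_eq_iff scaleR_2[symmetric])
qed

context frame_average
begin

text \<open>Existence of top eigenvectors and of a projection onto their span gives the choice in
  \<open>Pi_Gr\<close> its specified property; the frame is then taken from the eigenvectors that go
  with the chosen projection.\<close>

lemma classifying_frame_exists: "\<exists>V. classifying_frame average V"
proof -
  have "J \<noteq> {}" using weight_sum by auto
  from top_eigenvectors_exist[OF finite_J symmetric_average this average_psd]
  obtain v0 w0 where vw0: "top_eigenvectors average v0 w0" by blast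
  obtain P0 where P0: "orthogonal_projection_onto (span2_inf v0 w0) P0"
    using orthogonal_projection_exists[OF top_eigenvectors_orthonormal2[OF vw0]] by blast
  have "\<exists>v w. top_eigenvectors average v w \<and>
      orthogonal_projection_onto (span2_inf v w) (Pi_Gr average)"
    unfolding Pi_Gr_def sym_part_symmetric[OF symmetric_average]
    by (rule someI[of "\<lambda>P. \<exists>v w. top_eigenvectors average v w \<and>
      orthogonal_projection_onto (span2_inf v w) P"]) (use vw0 P0 in blast)
  then obtain v w where vw: "top_eigenvectors average v w"
    "orthogonal_projection_onto (span2_inf v w) (Pi_Gr average)" by blast
  have "classifying_frame average (frame_of v w)"
    unfolding classifying_frame_def
    using vw mat_frame_orthogonal_projection[OF top_eigenvectors_orthonormal2[OF vw(1)] vw(2)]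
    by blast
  then show ?thesis by blast
qed

lemma energy_le_two:
  assumes "V \<in> V2"
  shows "energy average V \<le> 2"
proof -
  have "orthonormal2 (col V 1) (col V 2)" using assms by (simp add: orthonormal2_col_iff V2_iff)
  then show ?thesis
    using average_le_one[of "col V 1"] average_le_one[of "col V 2"]
    by (simp add: energy_def orthonormal2_def)
qed

end

lemma nth_nth_le_norm: "\<bar>A $ i $ j\<bar> \<le> norm A" for A :: "real^2^2"
  using component_le_norm_cart[of "A $ i" j] Finite_Cartesian_Product.norm_nth_le[of A i] by linarith

lemma near_identity_det_trace:
  fixes S :: "real^2^2"
  assumes "norm (S - mat 1) \<le> 1 / 4"
  shows "0 < det S" "0 \<le> trace S"
proof -
  have e: "\<bar>(S - mat 1) $ i $ j\<bar> \<le> 1 / 4" for i j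
    using nth_nth_le_norm[of "S - mat 1" i j] assms by linarith
  have d: "3/4 \<le> S$1$1" "3/4 \<le> S$2$2" and o: "\<bar>S$1$2\<bar> \<le> 1/4" "\<bar>S$2$1\<bar> \<le> 1/4"
    using abs_le_D2[OF e[of 1 1]] abs_le_D2[OF e[of 2 2]] e[of 1 2] e[of 2 1]
    by (simp_all add: mat_def)
  have "(3/4) * (3/4) \<le> S$1$1 * S$2$2" using d by (intro mult_mono) auto
  moreover have "\<bar>S$1$2 * S$2$1\<bar> \<le> (1/4) * (1/4)" unfolding abs_mult using o by (intro mult_mono) auto
  ultimately show "0 < det S" unfolding det_2 by linarith
  show "0 \<le> trace S" using d by (simp add: trace_2)
qed

subsection \<open>Locally constant approximate cocycles\<close>

text \<open>\<open>C\<close> collects the constant values of \<open>\<Omega>\<close>. In the last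
  two assumptions the point b serves as witness that the sets involved meet.\<close>

locale constant_approx_cocycle =
  fixes B :: "'b topology" and J :: "nat set" and U :: "nat \<Rightarrow> 'b set"
    and \<rho> :: "nat \<Rightarrow> 'b \<Rightarrow> real" and \<Omega> :: "'b family" and C :: "nat \<Rightarrow> nat \<Rightarrow> real^2^2"
  assumes finite_J: "finite J"
    and U_open: "\<And>j. j \<in> J \<Longrightarrow> openin B (U j)"
    and pou: "partition_of_unity B J U \<rho>"
    and const: "\<And>j k b. j \<in> J \<Longrightarrow> k \<in> J \<Longrightarrow> b \<in> U j \<Longrightarrow> b \<in> U k \<Longrightarrow> \<Omega> j k b = C j k"
    and orth: "\<And>j k b. j \<in> J \<Longrightarrow> k \<in> J \<Longrightarrow> b \<in> U j \<Longrightarrow> b \<in> U k \<Longrightarrow> orthogonal_matrix (C j k)"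
    and approx: "\<And>j k l b. j \<in> J \<Longrightarrow> k \<in> J \<Longrightarrow> l \<in> J \<Longrightarrow> b \<in> U j \<Longrightarrow> b \<in> U k \<Longrightarrow> b \<in> U l \<Longrightarrow>
      norm (C j k ** C k l - C j l) \<le> 1 / 9"
begin

text \<open>Agrees with \<open>Psi\<close> on \<open>U j\<close>, but is built from the constants
  without a case distinction on zero weights, so its continuity is that of the weights.\<close>

definition frame :: "'b \<Rightarrow> nat \<Rightarrow> inf_frame" where
  "frame b j = (\<lambda>i. if i \<in> J then sqrt (\<rho> i b) *\<^sub>R C i j else 0)"

lemma U_sub: "j \<in> J \<Longrightarrow> b \<in> U j \<Longrightarrow> b \<in> topspace B"
  using U_open openin_subset by blast

lemma weight:
  assumes "b \<in> topspace B"
  shows "\<And>j. j \<in> J \<Longrightarrow> 0 \<le> \<rho> j b" "(\<Sum>j\<in>J. \<rho> j b) = 1"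
    "\<And>j. j \<in> J \<Longrightarrow> \<rho> j b \<noteq> 0 \<Longrightarrow> b \<in> U j"
proof -
  show "0 \<le> \<rho> j b" if "j \<in> J" for j using pou assms that by (auto simp: partition_of_unity_def)
  show "(\<Sum>j\<in>J. \<rho> j b) = 1" using pou assms by (auto simp: partition_of_unity_def)
  show "b \<in> U j" if j: "j \<in> J" "\<rho> j b \<noteq> 0" for j
  proof -
    have "b \<in> {b \<in> topspace B. \<rho> j b \<noteq> 0}" using assms j by simp
    also have "\<dots> \<subseteq> B closure_of {b \<in> topspace B. \<rho> j b \<noteq> 0}"
      by (intro closure_of_subset) auto
    also have "\<dots> \<subseteq> U j" using pou j by (auto simp: partition_of_unity_def)
    finally show ?thesis .
  qed
qed

lemma weighted_sum_le:
  assumes "b \<in> topspace B" "\<And>i. i \<in> J \<Longrightarrow> b \<in> U i \<Longrightarrow> f i \<le> c"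
  shows "(\<Sum>i\<in>J. \<rho> i b * f i) \<le> c"
proof -
  have "(\<Sum>i\<in>J. \<rho> i b * f i) \<le> (\<Sum>i\<in>J. \<rho> i b * c)"
  proof (rule sum_mono)
    fix i assume i: "i \<in> J"
    show "\<rho> i b * f i \<le> \<rho> i b * c"
      using weight(1,3)[OF assms(1) i] assms(2)[OF i]
      by (cases "\<rho> i b = 0") (auto intro: mult_left_mono)
  qed
  also have "\<dots> = c" by (simp add: sum_distrib_right[symmetric] weight[OF assms(1)])
  finally show ?thesis .
qed

lemma frame_outside: "i \<notin> J \<Longrightarrow> frame b j i = 0"
  by (simp add: frame_def)

lemma finsupp_frame [simp]: "finsupp (frame b j)"
  using finite_J frame_outside by (rule finsuppI)

lemma frame_V2:
  assumes "j \<in> J" "b \<in> U j"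
  shows "frame b j \<in> V2"
proof -
  note b = U_sub[OF assms]
  have "gram_inf (frame b j) (frame b j) = (\<Sum>i\<in>J. transpose (frame b j i) ** frame b j i)"
    using finite_J by (intro gram_inf_eq_sum) (auto simp: frame_outside)
  also have "\<dots> = (\<Sum>i\<in>J. \<rho> i b *\<^sub>R mat 1)"
  proof (rule sum.cong[OF refl])
    fix i assume i: "i \<in> J"
    show "transpose (frame b j i) ** frame b j i = \<rho> i b *\<^sub>R mat 1"
    proof (cases "\<rho> i b = 0")
      case True
      then show ?thesis using i by (simp add: frame_def matrix2_simps)
    next
      case False
      then have "orthogonal_matrix (C i j)" using orth[OF i assms(1) weight(3)[OF b i] assms(2)] by simp
      then show ?thesis
        using i weight(1)[OF b i]
        by (simp add: frame_def orthogonal_matrix transpose_scalar matrix_scalar_ac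
            scalar_matrix_assoc[symmetric])
    qed
  qed
  also have "\<dots> = mat 1" by (simp add: scaleR_sum_left[symmetric] weight[OF b])
  finally show ?thesis by (simp add: V2_iff)
qed

lemma frame_average: "b \<in> topspace B \<Longrightarrow> frame_average J (\<lambda>j. \<rho> j b) (frame b)"
  using finite_J weight frame_outside frame_V2 by unfold_locales auto

abbreviation "avg b \<equiv> frame_average.average J (\<lambda>j. \<rho> j b) (frame b)"

lemma Psi_eq_frame:
  assumes "j \<in> J" "b \<in> U j"
  shows "Psi J \<rho> \<Omega> j b = frame b j"
proof
  fix i
  note b = U_sub[OF assms]
  show "Psi J \<rho> \<Omega> j b i = frame b j i"
    using weight(3)[OF b] assms const[of i j b] by (auto simp: Psi_def frame_def)
qed

lemma cl_eq_average:
  assumes b: "b \<in> topspace B"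
  shows "cl J \<rho> \<Omega> b = avg b"
proof -
  interpret frame_average J "\<lambda>j. \<rho> j b" "frame b" by (rule frame_average[OF b])
  \<comment> \<open>The two frames may differ off \<open>U j\<close>, where the weight is
    zero.\<close>
  have "\<rho> j b *\<^sub>R (Psi J \<rho> \<Omega> j b i ** transpose (Psi J \<rho> \<Omega> j b k)) =
    \<rho> j b *\<^sub>R (frame b j i ** transpose (frame b j k))" if "j \<in> J" for i j k
    using Psi_eq_frame[OF that] weight(3)[OF b that] by (cases "\<rho> j b = 0") auto
  then show ?thesis unfolding cl_def average_def by (intro ext sum.cong refl)
qed

text \<open>Chosen separately at each point, so V itself need not be continuous; continuity is
  proved below for V V^T.\<close>

definition V :: "'b \<Rightarrow> inf_frame" where
  "V b = (SOME V. classifying_frame (avg b) V)"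

lemma V: "b \<in> topspace B \<Longrightarrow> classifying_frame (avg b) (V b)"
  unfolding V_def using frame_average.classifying_frame_exists[OF frame_average]
  by (metis someI_ex)

lemma V_V2: "b \<in> topspace B \<Longrightarrow> V b \<in> V2"
  using V classifying_frame_V2 by blast

text \<open>The block with index i of the difference is sqrt (\<open>\<rho> i b\<close>) times a
  cocycle defect, so the squared norm is a weighted mean of numbers at most (1/9)^2.\<close>

lemma frame_compare:
  assumes "j \<in> J" "k \<in> J" "b \<in> U j" "b \<in> U k"
  shows "ip (\<lambda>i. frame b k i - frame b j i ** C j k) (\<lambda>i. frame b k i - frame b j i ** C j k) \<le> 1 / 81"
proof -
  note b = U_sub[OF assms(1,3)]
  have "ip (\<lambda>i. frame b k i - frame b j i ** C j k) (\<lambda>i. frame b k i - frame b j i ** C j k)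
     = (\<Sum>i\<in>J. (frame b k i - frame b j i ** C j k) \<bullet> (frame b k i - frame b j i ** C j k))"
    using finite_J by (intro ip_eq_sum) (auto simp: frame_outside matrix2_simps)
  also have "\<dots> = (\<Sum>i\<in>J. \<rho> i b * (norm (C i k - C i j ** C j k))\<^sup>2)"
  proof (rule sum.cong[OF refl])
    fix i assume i: "i \<in> J"
    have "frame b k i - frame b j i ** C j k = sqrt (\<rho> i b) *\<^sub>R (C i k - C i j ** C j k)"
      using i by (simp add: frame_def scalar_matrix_assoc[symmetric] scaleR_diff_right)
    then show "(frame b k i - frame b j i ** C j k) \<bullet> (frame b k i - frame b j i ** C j k) =
        \<rho> i b * (norm (C i k - C i j ** C j k))\<^sup>2"
      using weight(1)[OF b i] by (simp add: power2_norm_eq_inner)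
  qed
  also have "\<dots> \<le> 1 / 81"
  proof (rule weighted_sum_le[OF b])
    fix i assume "i \<in> J" "b \<in> U i"
    then have "norm (C i k - C i j ** C j k) \<le> 1 / 9"
      using approx[of i j k b] assms by (simp add: norm_minus_commute)
    then have "(norm (C i k - C i j ** C j k))\<^sup>2 \<le> (1 / 9)\<^sup>2" by (intro power_mono) auto
    then show "(norm (C i k - C i j ** C j k))\<^sup>2 \<le> 1 / 81" by (simp add: power2_eq_square)
  qed
  finally show ?thesis .
qed

text \<open>The energy is the weighted mean of the squared norms of the Gram matrices with
  \<open>frame b k\<close>. By Pythagoras each of these falls short of 2 by at most the squared
  distance in \<open>frame_compare\<close>.\<close>

lemma energy_frame:
  assumes "j \<in> J" "b \<in> U j"
  shows "2 - 1 / 81 \<le> energy (avg b) (frame b j)"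
proof -
  note b = U_sub[OF assms]
  interpret frame_average J "\<lambda>j. \<rho> j b" "frame b" by (rule frame_average[OF b])
  have "(\<Sum>k\<in>J. \<rho> k b * (2 - (norm (gram_inf (frame b k) (frame b j)))\<^sup>2)) \<le> 1 / 81"
  proof (rule weighted_sum_le[OF b])
    fix k assume k: "k \<in> J" "b \<in> U k"
    have "ip (\<lambda>i. frame b j i - frame b k i ** C k j) (\<lambda>i. frame b j i - frame b k i ** C k j) \<le> 1 / 81"
      using frame_compare k assms by blast
    then show "2 - (norm (gram_inf (frame b k) (frame b j)))\<^sup>2 \<le> 1 / 81"
      unfolding ip_diff_frame_mult[OF finsupp_frame frame_V2[OF k]] ip_V2[OF frame_V2[OF assms]]
      by (smt (verit) zero_le_power2)
  qed
  moreover have "(\<Sum>k\<in>J. \<rho> k b * (2 - (norm (gram_inf (frame b k) (frame b j)))\<^sup>2)) =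
      2 - energy average (frame b j)"
    by (simp add: energy_average right_diff_distrib sum_subtractf sum_distrib_right[symmetric] weight[OF b])
  ultimately show ?thesis by simp
qed

text \<open>Some weight is nonzero, and the frame of that index is a near maximiser with \<delta> =
  1/81; the factor is 1 - 2/81.\<close>

lemma energy_gap_V:
  assumes b: "b \<in> topspace B" and Q: "Q \<in> V2"
  shows "79 / 81 * (2 - (norm (gram_inf (V b) Q))\<^sup>2) \<le> energy (avg b) (V b) - energy (avg b) Q"
proof -
  interpret frame_average J "\<lambda>j. \<rho> j b" "frame b" by (rule frame_average[OF b])
  obtain j where "j \<in> J" "\<rho> j b \<noteq> 0" using weight_sum by (metis sum.neutral zero_neq_one)
  then have j: "j \<in> J" "b \<in> U j" using weight(3)[OF b] by auto
  obtain v w where "top_eigenvectors average v w" "V b = frame_of v w"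
    using V[OF b] by (auto simp: classifying_frame_def)
  then show ?thesis
    using energy_gap[of v w "frame b j" "1 / 81" Q] frame_V2[OF j] energy_frame[OF j] Q by simp
qed

section \<open>Orthogonal polar factors and the exact cocycle\<close>

definition G :: "nat \<Rightarrow> 'b \<Rightarrow> real^2^2" where
  "G j b = gram_inf (V b) (frame b j)"

definition R :: "nat \<Rightarrow> 'b \<Rightarrow> real^2^2" where
  "R j b = G j b ** inv_sqrt2 (transpose (G j b) ** G j b)"

text \<open>Energies lie between 2 - 1/81 and 2, so the gap inequality bounds 2 - |G|^2 by 1/79;
  passing to G^T G - 1 costs a factor 2.\<close>

lemma G_near_orthogonal:
  assumes "j \<in> J" "b \<in> U j"
  shows "norm (transpose (G j b) ** G j b - mat 1) \<le> 2 / 79"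
proof -
  note b = U_sub[OF assms]
  have "79 / 81 * (2 - (norm (G j b))\<^sup>2) \<le> energy (avg b) (V b) - energy (avg b) (frame b j)"
    unfolding G_def by (rule energy_gap_V[OF b frame_V2[OF assms]])
  also have "\<dots> \<le> 2 - (2 - 1 / 81)"
    using frame_average.energy_le_two[OF frame_average[OF b] V_V2[OF b]] energy_frame[OF assms]
    by (intro diff_mono)
  finally have "2 - (norm (G j b))\<^sup>2 \<le> 1 / 79" by simp
  moreover have "norm (transpose (G j b) ** G j b - mat 1) \<le> 2 * (2 - (norm (G j b))\<^sup>2)"
    unfolding G_def by (intro norm_one_minus_gram_square_le frame_V2 V_V2 assms b)
  ultimately show ?thesis by simp
qed

lemma det_G:
  assumes "j \<in> J" "b \<in> U j"
  shows "det (G j b) \<noteq> 0" "0 < det (transpose (G j b) ** G j b)" "0 \<le> trace (transpose (G j b) ** G j b)"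
  using near_identity_det_trace[of "transpose (G j b) ** G j b"] G_near_orthogonal[OF assms]
  by (auto simp: det_mul)

lemma R:
  assumes "j \<in> J" "b \<in> U j"
  shows "orthogonal_matrix (R j b)" "norm (R j b - G j b) \<le> 2 / 79"
    "Psi_tilde J \<rho> \<Omega> j b = (\<lambda>i. V b i ** R j b)"
proof -
  note b = U_sub[OF assms]
  note p = polar_factor_mult[OF V_V2[OF b] det_G(1)[OF assms], folded R_def]
  show "orthogonal_matrix (R j b)" by (rule p(2))
  show "norm (R j b - G j b) \<le> 2 / 79" using p(3) G_near_orthogonal[OF assms] by linarith
  have "mat_frame_inf (Pi_Gr (avg b)) (frame b j) = (\<lambda>i. V b i ** G j b)"
    using V[OF b] by (auto simp: classifying_frame_def G_def)
  then show "Psi_tilde J \<rho> \<Omega> j b = (\<lambda>i. V b i ** R j b)"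
    by (simp add: Psi_tilde_def classifying_map_def cl_eq_average[OF b] Psi_eq_frame[OF assms] p(1))
qed

text \<open>Both frames have the form V R with the same V, and V^T V = 1 cancels in the Gram
  matrix.\<close>

lemma Pi_Z_eq:
  assumes "j \<in> J" "k \<in> J" "b \<in> U j" "b \<in> U k"
  shows "Pi_Z J \<rho> \<Omega> j k b = transpose (R j b) ** R k b"
proof -
  have "finsupp (V b)" "gram_inf (V b) (V b) = mat 1"
    using V_V2[OF U_sub[OF assms(1,3)]] by (auto simp: V2_iff)
  then show ?thesis
    using assms by (simp add: Pi_Z_def R gram_inf_mult_left gram_inf_mult_right)
qed

lemma Pi_Z_orthogonal:
  assumes "j \<in> J" "k \<in> J" "b \<in> U j" "b \<in> U k"
  shows "orthogonal_matrix (Pi_Z J \<rho> \<Omega> j k b)"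
  using R(1) assms by (simp add: Pi_Z_eq orthogonal_matrix_mul)

lemma Pi_Z_cocycle:
  assumes "j \<in> J" "k \<in> J" "l \<in> J" "b \<in> U j" "b \<in> U k" "b \<in> U l"
  shows "Pi_Z J \<rho> \<Omega> j k b ** Pi_Z J \<rho> \<Omega> k l b = Pi_Z J \<rho> \<Omega> j l b"
proof -
  have "R k b ** transpose (R k b) = mat 1"
    using R(1) assms by (simp add: orthogonal_matrix_def)
  then have "R k b ** (transpose (R k b) ** R l b) = R l b" by (simp add: matrix_mul_assoc)
  then show ?thesis using assms by (simp add: Pi_Z_eq matrix_mul_assoc[symmetric])
qed

text \<open>After multiplication by \<open>R j b\<close> the difference splits into two polar errors
  of at most 2/79 and the mismatch between \<open>G k b\<close> and \<open>G j b ** C j k\<close>.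
  The latter is at most 1/9, since pairing with V does not increase the distance in
  \<open>frame_compare\<close>.\<close>

lemma Pi_Z_near:
  assumes "j \<in> J" "k \<in> J" "b \<in> U j" "b \<in> U k"
  shows "norm (C j k - Pi_Z J \<rho> \<Omega> j k b) < 1"
proof -
  note b = U_sub[OF assms(1,3)]
  note Rj = R[OF assms(1,3)] and Rk = R[OF assms(2,4)]
  have Vf: "finsupp (V b)" using V_V2[OF b] by (simp add: V2_iff)
  have "norm (C j k - Pi_Z J \<rho> \<Omega> j k b) = norm (R j b ** (C j k - transpose (R j b) ** R k b))"
    using Rj(1) assms by (simp add: Pi_Z_eq norm_orthogonal_mult)
  also have "R j b ** (C j k - transpose (R j b) ** R k b) = R j b ** C j k - R k b"
    using Rj(1) by (simp add: matrix_diff_ldistrib2 matrix_mul_assoc orthogonal_matrix_def)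
  also have "\<dots> = (R j b - G j b) ** C j k + (G j b ** C j k - G k b) + (G k b - R k b)"
    by (simp add: matrix2_simps algebra_simps)
  also have "norm \<dots> \<le> norm ((R j b - G j b) ** C j k) + norm (G j b ** C j k - G k b) + norm (G k b - R k b)"
    by (intro norm_triangle_le add_right_mono norm_triangle_ineq)
  also have "norm ((R j b - G j b) ** C j k) \<le> 2 / 79"
    using Rj(2) orth assms by (simp add: norm_orthogonal_mult)
  also have "norm (G k b - R k b) \<le> 2 / 79" using Rk(2) by (simp add: norm_minus_commute)
  also have "norm (G j b ** C j k - G k b) \<le> 1 / 9"
  proof -
    let ?X = "\<lambda>i. frame b k i - frame b j i ** C j k"
    have "gram_inf (V b) ?X = G k b - G j b ** C j k"
      using Vf by (simp add: G_def gram_inf_diff_right gram_inf_mult_right)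
    moreover have "(norm (gram_inf (V b) ?X))\<^sup>2 \<le> ip ?X ?X"
      by (intro norm_gram_inf_le V_V2 b) simp
    ultimately have "(norm (G j b ** C j k - G k b))\<^sup>2 \<le> 1 / 81"
      using frame_compare[OF assms] by (simp add: norm_minus_commute)
    then have "(norm (G j b ** C j k - G k b))\<^sup>2 \<le> (1 / 9)\<^sup>2" by (simp add: power2_eq_square)
    then show ?thesis by (rule power2_le_imp_le) simp
  qed
  finally show ?thesis by simp
qed

section \<open>Continuity of the projections and of the exact cocycle\<close>

definition proj :: "'b \<Rightarrow> nat \<Rightarrow> nat \<Rightarrow> real^2^2" where
  "proj b i l = V b i ** transpose (V b l)"

text \<open>Add the gap inequality at b, tested on V at a, to the one with a and b exchanged. By
  linearity of the energy the right sides add up to the pairing of the difference of averages with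
  the difference of projections, whose blocks have norm at most 4. The constant is 5 >= 4 *
  81/79.\<close>

lemma proj_distance:
  assumes b: "b \<in> topspace B" and a: "a \<in> topspace B"
  shows "(norm (proj b i l - proj a i l))\<^sup>2 \<le> 5 * (\<Sum>i\<in>J. \<Sum>k\<in>J. norm (avg b i k - avg a i k))"
proof -
  let ?m = "2 - (norm (gram_inf (V b) (V a)))\<^sup>2"
  have e: "energy (avg c) (V d) = (\<Sum>i\<in>J. \<Sum>k\<in>J. avg c i k \<bullet> proj d i k)"
    if "c \<in> topspace B" for c d
    unfolding proj_def
    by (intro energy_eq_sum finite_J frame_average.symmetric_average frame_average that)
  have "norm (gram_inf (V a) (V b)) = norm (gram_inf (V b) (V a))"
    using gram_inf_transpose[of "V b" "V a"] norm_transpose2 V_V2[OF b] by (metis V2_iff)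
  then have "79 / 81 * (2 * ?m) \<le> (energy (avg b) (V b) - energy (avg b) (V a)) +
      (energy (avg a) (V a) - energy (avg a) (V b))"
    using energy_gap_V[OF b V_V2[OF a]] energy_gap_V[OF a V_V2[OF b]] by simp
  also have "\<dots> = (\<Sum>i\<in>J. \<Sum>k\<in>J. (avg b i k - avg a i k) \<bullet> (proj b i k - proj a i k))"
    unfolding e[OF b] e[OF a] sum_subtractf[symmetric] sum.distrib[symmetric]
    by (intro sum.cong refl) (simp add: inner_diff_left inner_diff_right)
  also have "\<dots> \<le> (\<Sum>i\<in>J. \<Sum>k\<in>J. norm (avg b i k - avg a i k) * 4)"
  proof (intro sum_mono)
    fix i k
    have "norm (proj b i k - proj a i k) \<le> 4"
      using projection_block_bound[OF V_V2[OF b], of i k] projection_block_bound[OF V_V2[OF a], of i k]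
        norm_triangle_ineq4[of "proj b i k" "proj a i k"] by (simp add: proj_def)
    then have "norm (avg b i k - avg a i k) * norm (proj b i k - proj a i k) \<le> norm (avg b i k - avg a i k) * 4"
      by (intro mult_left_mono) auto
    then show "(avg b i k - avg a i k) \<bullet> (proj b i k - proj a i k) \<le> norm (avg b i k - avg a i k) * 4"
      using norm_cauchy_schwarz[of "avg b i k - avg a i k" "proj b i k - proj a i k"] by linarith
  qed
  finally have "79 / 81 * (2 * ?m) \<le> (\<Sum>i\<in>J. \<Sum>k\<in>J. norm (avg b i k - avg a i k)) * 4"
    by (simp add: sum_distrib_right)
  moreover have "(norm (proj b i l - proj a i l))\<^sup>2 \<le> 2 * ?m"
    using projection_block_distance[OF V_V2[OF b] V_V2[OF a], of i l] by (simp add: proj_def)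
  moreover have "0 \<le> (\<Sum>i\<in>J. \<Sum>k\<in>J. norm (avg b i k - avg a i k))" by (intro sum_nonneg) auto
  ultimately show ?thesis by linarith
qed

text \<open>With N the inverse root of G^T G, the matrix equals N_j^T (G_j^T G_k) N_k. Each factor
  is a continuous function of products G_p^T G_q, and these involve V only through V V^T.\<close>

lemma Pi_Z_tendsto:
  assumes jk: "j \<in> J" "k \<in> J" and a: "a \<in> U j" "a \<in> U k"
  defines "F \<equiv> atin (subtopology B (U j \<inter> U k)) a"
  shows "(Pi_Z J \<rho> \<Omega> j k \<longlongrightarrow> Pi_Z J \<rho> \<Omega> j k a) F"
proof -
  let ?X = "subtopology B (U j \<inter> U k)"
  note aB = U_sub[OF jk(1) a(1)]
  have aX: "a \<in> topspace ?X" using a aB by simp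
  have ev: "eventually (\<lambda>b. b \<in> topspace B \<and> b \<in> U j \<and> b \<in> U k) F"
    unfolding F_def eventually_atin using aX openin_topspace[of ?X]
    by (intro disjI2 exI[of _ "topspace ?X"]) auto
  have \<rho>: "(\<rho> i \<longlongrightarrow> \<rho> i a) F" if "i \<in> J" for i
  proof -
    have "continuous_map ?X euclideanreal (\<rho> i)"
      using pou that by (intro continuous_map_from_subtopology) (auto simp: partition_of_unity_def)
    then show ?thesis using aX by (simp add: continuous_map_atin F_def)
  qed
  have fr: "((\<lambda>b. frame b j i) \<longlongrightarrow> frame a j i) F" for i j
    unfolding frame_def by (cases "i \<in> J") (auto intro!: tendsto_intros \<rho>)
  have avg: "((\<lambda>b. avg b i l) \<longlongrightarrow> avg a i l) F" for i l
  proof -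
    let ?f = "\<lambda>b. \<Sum>j\<in>J. \<rho> j b *\<^sub>R (frame b j i ** transpose (frame b j l))"
    have tr: "((\<lambda>b. transpose (frame b j l)) \<longlongrightarrow> transpose (frame a j l)) F" for j
      unfolding transpose_def by (intro tendsto_intros fr)
    have "(?f \<longlongrightarrow> ?f a) F" by (intro tendsto_intros fr tr \<rho>)
    moreover have "?f b = avg b i l" if "b \<in> topspace B" for b
      using frame_average.average_def[OF frame_average[OF that]] by simp
    moreover have "eventually (\<lambda>b. ?f b = avg b i l) F"
      using ev by (rule eventually_mono) (simp add: calculation(2))
    ultimately show ?thesis
      using aB by (auto dest: Lim_transform_eventually)
  qed
  have proj: "((\<lambda>b. proj b i l) \<longlongrightarrow> proj a i l) F" for i l
  proof -
    let ?g = "\<lambda>b. 5 * (\<Sum>i\<in>J. \<Sum>k\<in>J. norm (avg b i k - avg a i k))"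
    have "(?g \<longlongrightarrow> 5 * (\<Sum>i\<in>J. \<Sum>k\<in>J. norm (avg a i k - avg a i k))) F"
      by (intro tendsto_intros avg)
    then have g0: "(?g \<longlongrightarrow> 0) F" by simp
    have "((\<lambda>b. (norm (proj b i l - proj a i l))\<^sup>2) \<longlongrightarrow> 0) F"
      using ev proj_distance[OF _ aB, of _ i l]
      by (intro tendsto_sandwich[OF _ _ tendsto_const g0]) (auto elim: eventually_mono)
    then have "((\<lambda>b. sqrt ((norm (proj b i l - proj a i l))\<^sup>2)) \<longlongrightarrow> sqrt 0) F"
      by (rule tendsto_real_sqrt)
    then show ?thesis
      by (simp add: tendsto_norm_zero_iff LIM_zero_iff)
  qed
  \<comment> \<open>Here the discontinuous choice of V disappears: only blocks of the projection and
    of the frames remain.\<close>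
  have gram: "transpose (G p b) ** G q b =
      (\<Sum>i\<in>J. \<Sum>l\<in>J. transpose (frame b p i) ** proj b i l ** frame b q l)" for p q b
  proof -
    have g: "G q b = (\<Sum>l\<in>J. transpose (V b l) ** frame b q l)" for q
      unfolding G_def using finite_J by (intro gram_inf_eq_sum) (auto simp: frame_outside)
    show ?thesis
      by (simp add: g transpose_sum matrix_transpose_mul matrix_mult_sum_left matrix_mult_sum_right
          proj_def matrix_mul_assoc)
         (rule sum.swap)
  qed
  have S: "((\<lambda>b. transpose (G p b) ** G q b) \<longlongrightarrow> transpose (G p a) ** G q a) F" for p q
  proof -
    have tr: "((\<lambda>b. transpose (frame b j l)) \<longlongrightarrow> transpose (frame a j l)) F" for j l
      unfolding transpose_def by (intro tendsto_intros fr)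
    show ?thesis unfolding gram by (intro tendsto_intros fr tr proj)
  qed
  define N where "N p b = inv_sqrt2 (transpose (G p b) ** G p b)" for p b
  have N: "(N j \<longlongrightarrow> N j a) F" "(N k \<longlongrightarrow> N k a) F"
    unfolding N_def using det_G[OF jk(1) a(1)] det_G[OF jk(2) a(2)]
    by (auto intro!: tendsto_inv_sqrt2 S)
  have NT: "((\<lambda>b. transpose (N j b)) \<longlongrightarrow> transpose (N j a)) F"
    unfolding transpose_def by (intro tendsto_intros N)
  let ?h = "\<lambda>b. transpose (N j b) ** (transpose (G j b) ** G k b) ** N k b"
  have "?h b = Pi_Z J \<rho> \<Omega> j k b" if "b \<in> U j" "b \<in> U k" for b
    using jk that by (simp add: Pi_Z_eq R_def N_def matrix_transpose_mul matrix_mul_assoc)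
  moreover have "(?h \<longlongrightarrow> ?h a) F" by (intro tendsto_intros NT S N)
  moreover have "eventually (\<lambda>b. ?h b = Pi_Z J \<rho> \<Omega> j k b) F"
    using ev by (rule eventually_mono) (simp add: calculation(1))
  ultimately show ?thesis
    using a by (auto dest: Lim_transform_eventually)
qed

lemma Pi_Z_O2_cocycle: "Pi_Z J \<rho> \<Omega> \<in> O2_cocycles B J U"
proof -
  have "continuous_map (subtopology B (U j \<inter> U k)) (top_of_set O2) (Pi_Z J \<rho> \<Omega> j k)"
    if "[j, k] \<in> nerve J U" for j k
  proof -
    have jk: "j \<in> J" "k \<in> J" using that by (auto simp: nerve_def)
    have "continuous_map (subtopology B (U j \<inter> U k)) euclidean (Pi_Z J \<rho> \<Omega> j k)"
      unfolding continuous_map_atin limitin_canonical_iff using jk by (auto intro: Pi_Z_tendsto)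
    then show ?thesis
      using jk Pi_Z_orthogonal by (auto simp: continuous_map_in_subtopology O2_def)
  qed
  then show ?thesis
    unfolding O2_cocycles_def O2_cochains_def using Pi_Z_cocycle by (auto simp: nerve_def)
qed

end

subsection \<open>Angles\<close>

lemma rotation2_nth [simp]:
  "rotation2 t $ 1 $ 1 = cos t" "rotation2 t $ 1 $ 2 = - sin t"
  "rotation2 t $ 2 $ 1 = sin t" "rotation2 t $ 2 $ 2 = cos t"
  by (simp_all add: rotation2_def vector_2)

lemma refl2_nth [simp]:
  "refl2 s $ 1 $ 1 = 1" "refl2 s $ 1 $ 2 = 0" "refl2 s $ 2 $ 1 = 0" "refl2 s $ 2 $ 2 = of_int s"
  by (simp_all add: refl2_def vector_2)

lemma rotation2_add: "rotation2 s ** rotation2 t = rotation2 (s + t)"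
  by (simp add: matrix2_simps sin_add cos_add algebra_simps)

lemma orthogonal_rotation2: "orthogonal_matrix (rotation2 t)"
  by (simp add: orthogonal_matrix matrix2_simps power2_eq_square[symmetric])

lemma det_rotation2 [simp]: "det (rotation2 t) = 1"
  by (simp add: det_2 power2_eq_square[symmetric])

lemma det_refl2 [simp]: "det (refl2 s) = of_int s"
  by (simp add: det_2)

lemma refl2_involution: "s \<in> {1, -1} \<Longrightarrow> refl2 s ** refl2 s = mat 1"
  by (auto simp: matrix2_simps)

lemma orthogonal_refl2: "s \<in> {1, -1} \<Longrightarrow> orthogonal_matrix (refl2 s)"
  by (auto simp: orthogonal_matrix matrix2_simps)

text \<open>Conjugation by a reflection reverses the sense of a rotation; this is the source of the
  sign in the twisted coboundary.\<close>

lemma rotation2_refl2_mult: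
  assumes "s \<in> {1, -1}"
  shows "(rotation2 x ** refl2 s) ** (rotation2 y ** refl2 t) = rotation2 (x + of_int s * y) ** refl2 (s * t)"
  using assms by (auto simp: matrix2_simps sin_add cos_add sin_diff cos_diff algebra_simps)

lemma int_det_orthogonal:
  assumes "orthogonal_matrix C" "real_of_int s = det C"
  shows "s \<in> {1, -1}"
  using det_orthogonal_matrix[OF assms(1)] assms(2) by auto

lemma rotation2_refl2_iff:
  assumes "s \<in> {1, -1}"
  shows "W ** refl2 s = rotation2 t \<longleftrightarrow> W = rotation2 t ** refl2 s"
  using refl2_involution[OF assms] by (metis matrix_mul_assoc matrix_mul_rid)

text \<open>The norm bound makes the diagonal positive, which excludes reflections. For a rotation
  by t the squared norm is 4 - 4 cos t, so cos t exceeds 1/2 = cos (pi/3).\<close>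

lemma orthogonal_near_identity:
  fixes M :: "real^2^2"
  assumes orth: "orthogonal_matrix M" and near: "norm (M - mat 1) < 1"
  shows "M = rotation2 (arcsin (M$2$1))" "\<bar>arcsin (M$2$1)\<bar> < pi / 3" "-1 < M$2$1" "M$2$1 < 1"
proof -
  have e: "\<bar>(M - mat 1)$i$j\<bar> < 1" for i j
    using nth_nth_le_norm[of "M - mat 1" i j] near by linarith
  have pos: "0 < M$1$1" "0 < M$2$2"
    using e[of 1 1] e[of 2 2] by (auto simp: mat_def abs_less_iff)
  have c: "(M$1$1)\<^sup>2 + (M$2$1)\<^sup>2 = 1" "(M$1$2)\<^sup>2 + (M$2$2)\<^sup>2 = 1"
    "M$1$1 * M$1$2 + M$2$1 * M$2$2 = 0"
    using orth by (auto simp: orthogonal_matrix matrix2_simps power2_eq_square)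
  have "(M$2$2)\<^sup>2 * ((M$1$1)\<^sup>2 + (M$2$1)\<^sup>2) = (M$1$1)\<^sup>2 * ((M$1$2)\<^sup>2 + (M$2$2)\<^sup>2)"
    using c(3) by algebra
  then have "(M$2$2)\<^sup>2 = (M$1$1)\<^sup>2" by (simp add: c)
  then have d: "M$2$2 = M$1$1" using pos by (simp add: power2_eq_iff)
  have "M$1$1 * (M$1$2 + M$2$1) = 0" using c(3) d by (simp add: algebra_simps)
  then have o: "M$1$2 = - M$2$1" using pos by (auto simp: eq_neg_iff_add_eq_0)
  have sq: "(M$2$1)\<^sup>2 < 1" using c(1) pos by (smt (verit) zero_less_power)
  then have "\<bar>M$2$1\<bar> < 1" by (simp add: abs_square_less_1)
  then show s: "-1 < M$2$1" "M$2$1 < 1" by (auto simp: abs_less_iff)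
  have "sqrt (1 - (M$2$1)\<^sup>2) = M$1$1" using c(1) pos by (simp add: real_sqrt_unique)
  then have cs: "cos (arcsin (M$2$1)) = M$1$1" "sin (arcsin (M$2$1)) = M$2$1"
    using s by (auto simp: cos_arcsin)
  then show "M = rotation2 (arcsin (M$2$1))"
    using d o by (simp add: vec_eq_iff forall_2)
  have "(norm (M - mat 1))\<^sup>2 < 1" using near by (simp add: power_less_one_iff abs_square_less_1)
  moreover have "(norm (M - mat 1))\<^sup>2 = 4 - 4 * M$1$1"
    using c(1) unfolding power2_norm_eq_inner
    by (simp add: inner_vec_def sum_2 mat_def d o power2_eq_square algebra_simps)
  ultimately have "1 / 2 < M$1$1" by linarith
  then have gt: "cos (pi / 3) < cos \<bar>arcsin (M$2$1)\<bar>" by (simp add: cs cos_60)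
  show "\<bar>arcsin (M$2$1)\<bar> < pi / 3"
  proof (rule ccontr)
    assume "\<not> \<bar>arcsin (M$2$1)\<bar> < pi / 3"
    moreover have "\<bar>arcsin (M$2$1)\<bar> \<le> pi" using s arcsin_bounded[of "M$2$1"] pi_gt_zero by auto
    ultimately have "cos \<bar>arcsin (M$2$1)\<bar> \<le> cos (pi / 3)" by (intro cos_monotone_0_pi_le) auto
    then show False using gt by linarith
  qed
qed

text \<open>Undoing the constant rotation and the reflection leaves a matrix near 1, whose angle is
  a continuous arcsine of absolute value below pi/3, that is 1/6 of a turn.\<close>

lemma continuous_angle_near_constant:
  fixes W :: "'b \<Rightarrow> real^2^2"
  assumes cont: "continuous_map X euclidean W"
    and orth: "\<And>b. b \<in> topspace X \<Longrightarrow> orthogonal_matrix (W b)"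
    and near: "\<And>b. b \<in> topspace X \<Longrightarrow> norm (C - W b) < 1"
    and C: "orthogonal_matrix C" "real_of_int s = det C" "C ** refl2 s = rotation2 (2 * pi * \<theta>)"
  shows "\<exists>\<Theta>. continuous_map X euclideanreal \<Theta> \<and> (\<forall>b\<in>topspace X. real_of_int s = det (W b) \<and>
    W b ** refl2 s = rotation2 (2 * pi * \<Theta> b) \<and> \<bar>\<Theta> b - \<theta>\<bar> < 1 / 6)"
proof -
  have s: "s \<in> {1, -1}" using C by (intro int_det_orthogonal)
  define T where "T = rotation2 (2 * pi * \<theta>)"
  have T: "orthogonal_matrix T" "orthogonal_matrix (transpose T)" "T ** transpose T = mat 1" "transpose T ** T = mat 1"
    using orthogonal_rotation2[of "2 * pi * \<theta>"]
    by (auto simp: T_def orthogonal_matrix_transpose orthogonal_matrix_def)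
  define M where "M b = transpose T ** (W b ** refl2 s)" for b
  have "orthogonal_matrix (M b)" if "b \<in> topspace X" for b
    unfolding M_def by (intro orthogonal_matrix_mul T orth that orthogonal_refl2 s)
  moreover have "norm (M b - mat 1) < 1" if "b \<in> topspace X" for b
  proof -
    have "M b - mat 1 = transpose T ** (W b ** refl2 s - C ** refl2 s)"
      using T by (simp add: M_def matrix_diff_ldistrib2 C(3) T_def[symmetric])
    also have "W b ** refl2 s - C ** refl2 s = (W b - C) ** refl2 s"
      by (simp add: matrix2_simps algebra_simps)
    finally show ?thesis
      using near[OF that] T s by (simp add: norm_orthogonal_mult orthogonal_refl2 norm_minus_commute)
  qed
  ultimately have M: "M b = rotation2 (arcsin (M b$2$1))" "\<bar>arcsin (M b$2$1)\<bar> < pi / 3"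
    "-1 < M b$2$1" "M b$2$1 < 1" if "b \<in> topspace X" for b
    using orthogonal_near_identity[of "M b"] that by auto
  define \<Theta> where "\<Theta> b = \<theta> + arcsin (M b$2$1) / (2 * pi)" for b
  have "continuous_map X euclideanreal \<Theta>"
    unfolding continuous_map_atin limitin_canonical_iff
  proof
    fix a assume a: "a \<in> topspace X"
    then have "(W \<longlongrightarrow> W a) (atin X a)" using cont by (simp add: continuous_map_atin)
    then show "(\<Theta> \<longlongrightarrow> \<Theta> a) (atin X a)"
    proof -
      assume W: "(W \<longlongrightarrow> W a) (atin X a)"
      have "((\<lambda>b. M b$2$1) \<longlongrightarrow> M a$2$1) (atin X a)"
        unfolding M_def by (intro tendsto_intros W)
      then show ?thesis
        unfolding \<Theta>_def using M(3,4)[OF a]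
        by (intro tendsto_add tendsto_divide isCont_tendsto_compose[OF isCont_arcsin] tendsto_const) auto
    qed
  qed
  moreover have "real_of_int s = det (W b) \<and>
    W b ** refl2 s = rotation2 (2 * pi * \<Theta> b) \<and> \<bar>\<Theta> b - \<theta>\<bar> < 1 / 6" if b: "b \<in> topspace X" for b
  proof -
    have "W b ** refl2 s = T ** M b" using T by (simp add: M_def matrix_mul_assoc)
    also have "\<dots> = rotation2 (2 * pi * \<Theta> b)"
      by (subst M(1)[OF b]) (simp add: T_def rotation2_add \<Theta>_def distrib_left)
    finally have W: "W b ** refl2 s = rotation2 (2 * pi * \<Theta> b)" .
    have "det (W b) * of_int s = 1" using arg_cong[OF W, of det] by (simp add: det_mul)
    then have "real_of_int s = det (W b)" using s by auto
    moreover have "\<bar>\<Theta> b - \<theta>\<bar> < 1 / 6"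
      using M(2)[OF b] by (simp add: \<Theta>_def abs_divide field_simps)
    ultimately show ?thesis using W by simp
  qed
  ultimately show ?thesis by blast
qed

text \<open>Moving the first reflection past the second rotation writes both sides of the cocycle
  identity as a rotation times the same reflection; the two angles then agree modulo 2 pi.\<close>

lemma cocycle_angle_integer:
  assumes s: "s \<in> {1, -1}" and t: "t \<in> {1, -1}"
    and eq: "W1 ** W2 = W3"
    and W: "W1 ** refl2 s = rotation2 (2 * pi * x)" "W2 ** refl2 t = rotation2 (2 * pi * y)"
      "W3 ** refl2 (s * t) = rotation2 (2 * pi * z)"
  shows "of_int s * y - z + x \<in> \<int>"
proof -
  have st: "s * t \<in> {1, -1}" using s t by auto
  have "rotation2 (2 * pi * x + of_int s * (2 * pi * y)) ** refl2 (s * t)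
      = rotation2 (2 * pi * z) ** refl2 (s * t)"
    using eq W(1)[unfolded rotation2_refl2_iff[OF s]] W(2)[unfolded rotation2_refl2_iff[OF t]]
      W(3)[unfolded rotation2_refl2_iff[OF st]] rotation2_refl2_mult[OF s] by metis
  then have "rotation2 (2 * pi * x + of_int s * (2 * pi * y)) = rotation2 (2 * pi * z)"
    using refl2_involution[OF st] by (metis matrix_mul_assoc matrix_mul_rid)
  then have "sin (2 * pi * x + of_int s * (2 * pi * y)) = sin (2 * pi * z)"
    "cos (2 * pi * x + of_int s * (2 * pi * y)) = cos (2 * pi * z)"
    by (metis rotation2_nth)+
  then obtain n :: int where "2 * pi * x + of_int s * (2 * pi * y) = 2 * pi * z + 2 * pi * of_int n"
    using sin_cos_eq_iff by blast
  then have "2 * pi * (of_int s * y - z + x) = 2 * pi * of_int n" by (simp add: algebra_simps)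
  then have "of_int s * y - z + x = of_int n" by simp
  then show ?thesis by simp
qed

section \<open>From continuous angles to integer cocycles\<close>

lemma connected_integer_valued_constant:
  assumes "connected_space X" "continuous_map X euclideanreal f"
    and int: "\<And>x. x \<in> topspace X \<Longrightarrow> f x \<in> \<int>" and "x \<in> topspace X" "y \<in> topspace X"
  shows "f x = f y"
proof -
  have "connectedin euclideanreal (f ` topspace X)"
    using assms(1,2) connectedin_continuous_map_image connectedin_topspace by blast
  then have c: "connected (f ` topspace X)" by simp
  have False if xy: "x \<in> topspace X" "y \<in> topspace X" "f x < f y" for x y
  proof -
    obtain m n :: int where mn: "f x = of_int m" "f y = of_int n"
      using int xy by (metis Ints_cases)
    then have "m + 1 \<le> n" using xy by simp
    \<comment> \<open>Two distinct integer values would force this half-integer between them to be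
      attained as well.\<close>
    then have "of_int m + 1 / 2 \<in> {f x..f y}" using mn by simp
    then have "of_int m + 1 / 2 \<in> f ` topspace X"
      using connected_contains_Icc[OF c, of "f x" "f y"] xy by blast
    then obtain k :: int where "of_int m + 1 / 2 = real_of_int k"
      using int by (metis Ints_cases imageE)
    then have "2 * m + 1 = 2 * k" by linarith
    then show False by presburger
  qed
  then show ?thesis using assms(4,5) by (meson linorder_less_linear)
qed

lemma nerve_iff: "js \<in> nerve J U \<longleftrightarrow> js \<noteq> [] \<and> set js \<subseteq> J \<and> (\<exists>b. \<forall>j\<in>set js. b \<in> U j)"
  by (auto simp: nerve_def)

lemma good_cover_connected:
  assumes "good_open_cover B J U" "[j, k] \<in> nerve J U"
  shows "connected_space (subtopology B (U j \<inter> U k))"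
  using assms contractible_imp_connected_space by (fastforce simp: good_open_cover_def)

lemma good_cover_topspace:
  assumes "good_open_cover B J U" "[j, k] \<in> nerve J U"
  shows "topspace (subtopology B (U j \<inter> U k)) = U j \<inter> U k"
proof -
  have "openin B (U j)" using assms by (auto simp: good_open_cover_def nerve_iff)
  then show ?thesis using openin_subset by fastforce
qed

text \<open>At a common point e is the twisted coboundary of a real cochain, and applying the
  coboundary twice gives zero because \<omega> is multiplicative.\<close>

lemma twisted_cocycle_of_angles:
  assumes \<omega>: "\<omega> \<in> sign_cocycles J U"
    and e: "\<And>j k l b. [j,k,l] \<in> nerve J U \<Longrightarrow> b \<in> U j \<inter> U k \<inter> U l \<Longrightarrow>
      real_of_int (e j k l) = of_int (\<omega> j k) * \<Theta> k l b - \<Theta> j l b + \<Theta> j k b"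
  shows "e \<in> twisted_2_cocycles J U \<omega>"
  unfolding twisted_2_cocycles_def
proof (intro CollectI allI impI)
  fix j k l m assume n: "[j, k, l, m] \<in> nerve J U"
  then obtain b where b: "b \<in> U j" "b \<in> U k" "b \<in> U l" "b \<in> U m" by (auto simp: nerve_iff)
  have f: "[j,k,l] \<in> nerve J U" "[j,k,m] \<in> nerve J U" "[j,l,m] \<in> nerve J U" "[k,l,m] \<in> nerve J U"
    using n by (auto simp: nerve_iff)
  have "\<omega> j l = \<omega> j k * \<omega> k l" using \<omega> f(1) by (auto simp: sign_cocycles_def)
  then have "real_of_int (twisted_delta2 \<omega> e j k l m) = 0"
    using b by (simp add: twisted_delta2_def e[OF f(1), of b] e[OF f(2), of b] e[OF f(3), of b]
        e[OF f(4), of b] algebra_simps)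
  then show "twisted_delta2 \<omega> e j k l m = 0" by (simp only: of_int_eq_0_iff)
qed

text \<open>Angles of W close to the constant ones have a coboundary that rounding recovers exactly,
  so (\<omega>, e) is itself computed from W. Any other choice of angles changes e by the coboundary
  of an integer cochain.\<close>

theorem near_constant_represents_characteristic_classes:
  assumes good: "good_open_cover B J U" and W: "W \<in> O2_cocycles B J U"
    and C: "\<And>j k. [j,k] \<in> nerve J U \<Longrightarrow> orthogonal_matrix (C j k)"
    and near: "\<And>j k b. [j,k] \<in> nerve J U \<Longrightarrow> b \<in> U j \<inter> U k \<Longrightarrow> norm (C j k - W j k b) < 1"
    and \<omega>: "\<And>j k. [j,k] \<in> nerve J U \<Longrightarrow> real_of_int (\<omega> j k) = det (C j k)"
    and \<Theta>: "\<And>j k. [j,k] \<in> nerve J U \<Longrightarrow> C j k ** refl2 (\<omega> j k) = rotation2 (2 * pi * \<Theta> j k)"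
    and e: "\<And>j k l. [j,k,l] \<in> nerve J U \<Longrightarrow>
      e j k l = round (of_int (\<omega> j k) * \<Theta> k l - \<Theta> j l + \<Theta> j k)"
  shows "represents_characteristic_classes B J U W \<omega> e"
proof -
  note top = good_cover_topspace[OF good]
  have cont: "continuous_map (subtopology B (U j \<inter> U k)) (top_of_set O2) (W j k)"
    if "[j,k] \<in> nerve J U" for j k
    using W that by (auto simp: O2_cocycles_def O2_cochains_def)
  have "\<exists>\<Theta>'. continuous_map (subtopology B (U j \<inter> U k)) euclideanreal \<Theta>' \<and>
      (\<forall>b\<in>U j \<inter> U k. real_of_int (\<omega> j k) = det (W j k b) \<and>
        W j k b ** refl2 (\<omega> j k) = rotation2 (2 * pi * \<Theta>' b) \<and> \<bar>\<Theta>' b - \<Theta> j k\<bar> < 1 / 6)"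
    if n: "[j,k] \<in> nerve J U" for j k
  proof -
    have c: "continuous_map (subtopology B (U j \<inter> U k)) euclidean (W j k)"
      and o: "\<And>b. b \<in> U j \<inter> U k \<Longrightarrow> orthogonal_matrix (W j k b)"
      using cont[OF n] top[OF n] by (auto simp: continuous_map_in_subtopology O2_def)
    show ?thesis
      using continuous_angle_near_constant[OF c, unfolded top[OF n], OF o near[OF n] C[OF n] \<omega>[OF n] \<Theta>[OF n]]
      by simp
  qed
  then obtain \<Psi> where \<Psi>: "\<And>j k. [j,k] \<in> nerve J U \<Longrightarrow>
      continuous_map (subtopology B (U j \<inter> U k)) euclideanreal (\<Psi> j k) \<and>
      (\<forall>b\<in>U j \<inter> U k. real_of_int (\<omega> j k) = det (W j k b) \<and>
        W j k b ** refl2 (\<omega> j k) = rotation2 (2 * pi * \<Psi> j k b) \<and> \<bar>\<Psi> j k b - \<Theta> j k\<bar> < 1 / 6)"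
    by metis
  have sign: "\<omega> j k \<in> {1, -1}" if "[j,k] \<in> nerve J U" for j k
    using C \<omega> that by (intro int_det_orthogonal)
  have WW: "W j k b ** W k l b = W j l b" if "[j,k,l] \<in> nerve J U" "b \<in> U j \<inter> U k \<inter> U l" for j k l b
    using W that by (auto simp: O2_cocycles_def)
  have faces: "[j,k] \<in> nerve J U" "[k,l] \<in> nerve J U" "[j,l] \<in> nerve J U"
    if "[j,k,l] \<in> nerve J U" for j k l
    using that by (auto simp: nerve_iff)
  have mult: "\<omega> j k * \<omega> k l = \<omega> j l" if n: "[j,k,l] \<in> nerve J U" for j k l
  proof -
    obtain b where b: "b \<in> U j" "b \<in> U k" "b \<in> U l" using n by (auto simp: nerve_iff)
    have "real_of_int (\<omega> j k * \<omega> k l) = real_of_int (\<omega> j l)"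
      using b \<Psi> faces[OF n] WW[OF n, of b] by (simp add: det_mul[symmetric])
    then show ?thesis by (simp only: of_int_eq_iff)
  qed
  have signs: "\<omega> \<in> sign_cocycles J U" using sign mult by (simp add: sign_cocycles_def)
  have e': "real_of_int (e j k l) = of_int (\<omega> j k) * \<Psi> k l b - \<Psi> j l b + \<Psi> j k b"
    if n: "[j,k,l] \<in> nerve J U" and b: "b \<in> U j \<inter> U k \<inter> U l" for j k l b
  proof -
    note f = faces[OF n]
    have p: "W j k b ** refl2 (\<omega> j k) = rotation2 (2 * pi * \<Psi> j k b)" "\<bar>\<Psi> j k b - \<Theta> j k\<bar> < 1 / 6"
      "W k l b ** refl2 (\<omega> k l) = rotation2 (2 * pi * \<Psi> k l b)" "\<bar>\<Psi> k l b - \<Theta> k l\<bar> < 1 / 6"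
      "W j l b ** refl2 (\<omega> j l) = rotation2 (2 * pi * \<Psi> j l b)" "\<bar>\<Psi> j l b - \<Theta> j l\<bar> < 1 / 6"
      using \<Psi> f b by auto
    have "of_int (\<omega> j k) * \<Psi> k l b - \<Psi> j l b + \<Psi> j k b \<in> \<int>"
      using sign[OF f(1)] sign[OF f(2)] WW[OF n b] p(1,3) p(5)[folded mult[OF n]]
      by (rule cocycle_angle_integer)
    then obtain m where m: "of_int (\<omega> j k) * \<Psi> k l b - \<Psi> j l b + \<Psi> j k b = of_int m"
      by (rule Ints_cases)
    have "\<bar>of_int (\<omega> j k) * \<Psi> k l b - of_int (\<omega> j k) * \<Theta> k l\<bar> < 1 / 6"
      using sign[OF f(1)] p(4) by (auto simp: abs_minus_commute)
    \<comment> \<open>Three errors, each below 1/6; the sign does not change the size of the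
      first.\<close>
    then have "\<bar>of_int (\<omega> j k) * \<Theta> k l - \<Theta> j l + \<Theta> j k - of_int m\<bar> < 1 / 2"
      unfolding m[symmetric] using p(2,6) by linarith
    then have "e j k l = m" unfolding e[OF n] by (rule round_unique')
    then show ?thesis using m by simp
  qed
  have "(\<omega>, e) \<in> characteristic_cocycles B J U W"
    unfolding characteristic_cocycles_def using \<Psi> e' by (auto intro!: exI[of _ \<Psi>])
  moreover have "equivalent_pairs J U (\<omega>, e) p" if "p \<in> characteristic_cocycles B J U W" for p
  proof -
    obtain \<omega>2 e2 \<Phi> where p: "p = (\<omega>2, e2)" and \<Phi>: "\<And>j k. [j,k] \<in> nerve J U \<Longrightarrow>
        continuous_map (subtopology B (U j \<inter> U k)) euclideanreal (\<Phi> j k) \<and>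
        (\<forall>b\<in>U j \<inter> U k. real_of_int (\<omega>2 j k) = det (W j k b) \<and>
          W j k b ** refl2 (\<omega>2 j k) = rotation2 (2 * pi * \<Phi> j k b))"
      and e2: "\<And>j k l b. [j,k,l] \<in> nerve J U \<Longrightarrow> b \<in> U j \<inter> U k \<inter> U l \<Longrightarrow>
        real_of_int (e2 j k l) = of_int (\<omega>2 j k) * \<Phi> k l b - \<Phi> j l b + \<Phi> j k b"
      using \<open>p \<in> _\<close> unfolding characteristic_cocycles_def by blast
    have \<omega>2: "\<omega>2 j k = \<omega> j k" if n: "[j,k] \<in> nerve J U" for j k
    proof -
      obtain b where "b \<in> U j \<inter> U k" using n by (auto simp: nerve_iff)
      then have "real_of_int (\<omega>2 j k) = real_of_int (\<omega> j k)" using \<Phi>[OF n] \<Psi>[OF n] by metis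
      then show ?thesis by (simp only: of_int_eq_iff)
    qed
    \<comment> \<open>Two continuous choices of angle differ by integers, and on a connected overlap
      by a single one.\<close>
    have "\<exists>\<beta>. \<forall>b\<in>U j \<inter> U k. \<Psi> j k b - \<Phi> j k b = of_int \<beta>" if n: "[j,k] \<in> nerve J U" for j k
    proof -
      have int: "\<Psi> j k b - \<Phi> j k b \<in> \<int>" if b: "b \<in> U j \<inter> U k" for b
      proof -
        have "rotation2 (2 * pi * \<Psi> j k b) = rotation2 (2 * pi * \<Phi> j k b)"
          using \<Psi>[OF n] \<Phi>[OF n] b \<omega>2[OF n] by metis
        then have "sin (2 * pi * \<Psi> j k b) = sin (2 * pi * \<Phi> j k b)"
          "cos (2 * pi * \<Psi> j k b) = cos (2 * pi * \<Phi> j k b)"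
          by (metis rotation2_nth)+
        then obtain m :: int where "2 * pi * \<Psi> j k b = 2 * pi * \<Phi> j k b + 2 * pi * of_int m"
          using sin_cos_eq_iff by blast
        then have "2 * pi * (\<Psi> j k b - \<Phi> j k b) = 2 * pi * of_int m" by (simp add: algebra_simps)
        then show ?thesis by simp
      qed
      have "continuous_map (subtopology B (U j \<inter> U k)) euclideanreal (\<lambda>b. \<Psi> j k b - \<Phi> j k b)"
        using \<Psi>[OF n] \<Phi>[OF n] by (intro continuous_map_diff) auto
      then have "\<Psi> j k a - \<Phi> j k a = \<Psi> j k b - \<Phi> j k b" if "a \<in> U j \<inter> U k" "b \<in> U j \<inter> U k" for a b
        using connected_integer_valued_constant[OF good_cover_connected[OF good n], of "\<lambda>b. \<Psi> j k b - \<Phi> j k b"]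
          int that unfolding top[OF n] by blast
      moreover obtain a where "a \<in> U j \<inter> U k" using n by (auto simp: nerve_iff)
      ultimately show ?thesis using int by (metis Ints_cases)
    qed
    then obtain \<beta> where \<beta>: "\<And>j k b. [j,k] \<in> nerve J U \<Longrightarrow> b \<in> U j \<inter> U k \<Longrightarrow>
        \<Psi> j k b - \<Phi> j k b = real_of_int (\<beta> j k)" by metis
    have "e j k l - e2 j k l = twisted_delta1 \<omega>2 \<beta> j k l" if n: "[j,k,l] \<in> nerve J U" for j k l
    proof -
      note f = faces[OF n]
      obtain b where b: "b \<in> U j \<inter> U k \<inter> U l" using n by (auto simp: nerve_iff)
      have "real_of_int (e j k l - e2 j k l) = real_of_int (twisted_delta1 \<omega>2 \<beta> j k l)"
        using b by (simp add: e'[OF n b] e2[OF n b] \<omega>2[OF f(1)] twisted_delta1_def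
            \<beta>[OF f(1), of b, symmetric] \<beta>[OF f(2), of b, symmetric] \<beta>[OF f(3), of b, symmetric] algebra_simps)
      then show ?thesis by (simp only: of_int_eq_iff)
    qed
    \<comment> \<open>The sign cochain can be constantly 1, as both sign cocycles are the
      determinant of W.\<close>
    then show ?thesis
      unfolding p equivalent_pairs_def twisted_cohomologous_def using \<omega>2
      by (auto intro!: exI[of _ "\<lambda>_. 1"])
  qed
  moreover have "e \<in> twisted_2_cocycles J U \<omega>"
    using signs e' by (rule twisted_cocycle_of_angles)
  ultimately show ?thesis
    unfolding represents_characteristic_classes_def using signs by blast
qed

section \<open>Reduction to constant matrices\<close>

lemma discrete_cochain_constant:
  assumes good: "good_open_cover B J U" and n: "[j,k] \<in> nerve J U"
    and disc: "continuous_map (subtopology B (U j \<inter> U k)) (discrete_topology O2) f"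
    and ab: "a \<in> U j \<inter> U k" "b \<in> U j \<inter> U k"
  shows "f a = f b"
proof -
  have "connectedin (discrete_topology O2) (f ` (U j \<inter> U k))"
    using connectedin_continuous_map_image[OF disc] connectedin_topspace good_cover_connected[OF good n]
    by (metis good_cover_topspace[OF good n])
  then show ?thesis using ab by (auto simp: connectedin_discrete_topology)
qed

lemma approx_O2_cocycle_bound:
  assumes "\<Omega> \<in> approx_O2_cocycles B J U \<epsilon>" "[j,k,l] \<in> nerve J U" "b \<in> U j \<inter> U k \<inter> U l"
  shows "norm (\<Omega> j k b ** \<Omega> k l b - \<Omega> j l b) < \<epsilon>"
proof -
  have "ennreal (norm (\<Omega> j k b ** \<Omega> k l b - \<Omega> j l b)) \<le>
      (SUP b \<in> U j \<inter> U k \<inter> U l. ennreal (norm (\<Omega> j k b ** \<Omega> k l b - \<Omega> j l b)))"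
    using assms(3) by (rule SUP_upper)
  also have "\<dots> \<le> (SUP (j,k,l) \<in> {(j,k,l). [j,k,l] \<in> nerve J U}. SUP b \<in> U j \<inter> U k \<inter> U l.
           ennreal (norm (\<Omega> j k b ** \<Omega> k l b - \<Omega> j l b)))"
    using assms(2) by (intro SUP_upper2[of "(j,k,l)"]) auto
  also have "\<dots> < ennreal \<epsilon>" using assms(1) by (simp add: approx_O2_cocycles_def)
  finally show ?thesis by (simp add: ennreal_less_iff)
qed

theorem corollary4p5:
  fixes B :: "'b topology" and J :: "nat set" and U :: "nat \<Rightarrow> 'b set"
    and \<rho> :: "nat \<Rightarrow> 'b \<Rightarrow> real" and \<Omega> :: "'b family" and \<epsilon> :: real
    and \<omega> :: "nat \<Rightarrow> nat \<Rightarrow> int" and \<Theta> :: "nat \<Rightarrow> nat \<Rightarrow> real"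
    and e :: "nat \<Rightarrow> nat \<Rightarrow> nat \<Rightarrow> int"
  assumes "paracompact_space B"
    and "finite J"
    and "good_open_cover B J U"
    and "partition_of_unity B J U \<rho>"
    and "\<epsilon> < 1/9"
    and "\<Omega> \<in> discrete_approx_O2_cocycles B J U \<epsilon>"
    and "\<And>j k b. [j,k] \<in> nerve J U \<Longrightarrow> b \<in> U j \<inter> U k \<Longrightarrow>
           real_of_int (\<omega> j k) = det (\<Omega> j k b)"
    and "\<And>j k b. [j,k] \<in> nerve J U \<Longrightarrow> b \<in> U j \<inter> U k \<Longrightarrow>
           \<Omega> j k b ** refl2 (\<omega> j k) = rotation2 (2 * pi * \<Theta> j k)"
    and "\<And>j k l. [j,k,l] \<in> nerve J U \<Longrightarrow>
           e j k l = round (of_int (\<omega> j k) * \<Theta> k l - \<Theta> j l + \<Theta> j k)"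
  shows "Pi_Z J \<rho> \<Omega> \<in> O2_cocycles B J U \<and>
         represents_characteristic_classes B J U (Pi_Z J \<rho> \<Omega>) \<omega> e"
proof -
  note good = assms(3)
  have approx: "\<Omega> \<in> approx_O2_cocycles B J U \<epsilon>"
    and disc: "\<And>j k. [j,k] \<in> nerve J U \<Longrightarrow>
      continuous_map (subtopology B (U j \<inter> U k)) (discrete_topology O2) (\<Omega> j k)"
    using assms(6) by (auto simp: discrete_approx_O2_cocycles_def)
  \<comment> \<open>On a nonempty overlap any point gives the same value by connectedness; on an
    empty one the value is arbitrary.\<close>
  define C where "C j k = \<Omega> j k (SOME b. b \<in> U j \<inter> U k)" for j k
  have C: "\<Omega> j k b = C j k" if n: "[j,k] \<in> nerve J U" and b: "b \<in> U j \<inter> U k" for j k b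
    unfolding C_def
    using discrete_cochain_constant[OF good n disc[OF n] b someI[of "\<lambda>b. b \<in> U j \<inter> U k", OF b]] .
  have C_orth: "orthogonal_matrix (C j k)" if n: "[j,k] \<in> nerve J U" for j k
  proof -
    obtain b where b: "b \<in> U j \<inter> U k" using n by (auto simp: nerve_iff)
    have "\<Omega> j k b \<in> O2"
      using continuous_map_funspace[OF disc[OF n]] b good_cover_topspace[OF good n] by auto
    then show ?thesis using C[OF n b] by (simp add: O2_def)
  qed
  interpret constant_approx_cocycle B J U \<rho> \<Omega> C
  proof
    show "finite J" "partition_of_unity B J U \<rho>" by fact+
    show "openin B (U j)" if "j \<in> J" for j
      using good that by (auto simp: good_open_cover_def)
    show "\<Omega> j k b = C j k" "orthogonal_matrix (C j k)"
      if "j \<in> J" "k \<in> J" "b \<in> U j" "b \<in> U k" for j k b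
      using C[of j k b] C_orth[of j k] that by (auto simp: nerve_iff)
    show "norm (C j k ** C k l - C j l) \<le> 1 / 9"
      if "j \<in> J" "k \<in> J" "l \<in> J" "b \<in> U j" "b \<in> U k" "b \<in> U l" for j k l b
    proof -
      have n: "[j,k,l] \<in> nerve J U" "[j,k] \<in> nerve J U" "[k,l] \<in> nerve J U" "[j,l] \<in> nerve J U"
        using that by (auto simp: nerve_iff)
      show ?thesis
        using approx_O2_cocycle_bound[OF approx n(1), of b] C[OF n(2), of b] C[OF n(3), of b]
          C[OF n(4), of b] that assms(5) by simp
    qed
  qed
  have "represents_characteristic_classes B J U (Pi_Z J \<rho> \<Omega>) \<omega> e"
  proof (rule near_constant_represents_characteristic_classes[OF good Pi_Z_O2_cocycle C_orth])
    show "norm (C j k - Pi_Z J \<rho> \<Omega> j k b) < 1" if "[j,k] \<in> nerve J U" "b \<in> U j \<inter> U k" for j k b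
      using that by (intro Pi_Z_near) (auto simp: nerve_iff)
    show "real_of_int (\<omega> j k) = det (C j k)"
      "C j k ** refl2 (\<omega> j k) = rotation2 (2 * pi * \<Theta> j k)" if n: "[j,k] \<in> nerve J U" for j k
    proof -
      obtain b where b: "b \<in> U j \<inter> U k" using n by (auto simp: nerve_iff)
      show "real_of_int (\<omega> j k) = det (C j k)"
        "C j k ** refl2 (\<omega> j k) = rotation2 (2 * pi * \<Theta> j k)"
        using assms(7,8)[OF n b] C[OF n b] by auto
    qed
  qed (use assms(9) in auto)
  then show ?thesis using Pi_Z_O2_cocycle by blast
qed

end
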